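(* Let $A_{n^+,n^-}$ be the commutative algebra with basis $\{C_\mu\}$ indexed by triples $\mu=(\kappa^+,\kappa^-,\lambda)$ with $n^\pm(\mu)=n^\pm$, and identify $A_{n^+,n^-}$ with the space of polynomials in $p_k^+,p_k^-,q_k$ that are bihomogeneous of bidegree $(n^+,n^-)$ via the linear isomorphism $p_\mu\leftrightarrow C_\mu/|C_\mu|$. Let $C_2\in A_{n^+,n^-}$ be the sum of all transpositions. Then under this identification, left multiplication by $C_2$ on $A_{n^+,n^-}$ coincides with the differential operator $W^+$ at $\hbar=1$: $$W^+\big|_{\hbar=1}=\sum_{i,j\ge1}\Big(p_i^{\bar i}p_j^{+}\frac{\partial}{\partial p_{i+j}^{\bar i}}+p_{i+j}^{\bar i}\frac{\partial^2}{\partial p_i^{\bar i}\partial p_j^{+}}\Big)+\sum_{i\ge1}\Big(i\,p_{2i}^{+}\frac{\partial}{\partial q_i}+q_i\frac{\partial}{\partial p_{2i}^{+}}\Big),$$ where $\bar i$ is $+$ for $i$ even and $-$ for $i$ odd.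
   Context: For a finite set $N=N^+\sqcup N^-$ with $|N^\pm|=n^\pm$: a state is a partition of $N$ into singletons and two-element subsets each containing one element of $N^+$ and one of $N^-$; a transition is an ordered pair $(s,s')$ of states (initial, final); composition $(s_1,s_1')(s_2,s_2')=(s_1,s_2')$ if $s_1'=s_2$ and $0$ otherwise. A transposition is a transition whose states differ only in two elements which form a pair in one state and are singletons in the other. $T_{n^+,n^-}$ is the $\mathbb{Q}$-algebra spanned by transitions with this product; $A_{n^+,n^-}$ is its $S(N^+)\times S(N^-)$-invariant subalgebra, with basis $C_\mu$ = sum of all transitions of type $\mu$, and $|C_\mu|$ is the number of transitions of type $\mu$. Type of $(s,s')$: in the graph on $N$ with edges the pairs of $s$ and $s'$, components are cycles (length $2\ell$) or paths; a path with an odd number of elements has the sign ($+$ for $N^+$, $-$ for $N^-$) of its endpoints; a path with an even number of elements is $+$ if both endpoints are singletons of $s$ and $-$ if both are singletons of $s'$; the type is $(\kappa^+,\kappa^-,\lambda)$ with $\kappa^\pm$ the numbers of elements of $\pm$ paths and $\lambda$ the half-lengths of cycles. $n^\pm(\mu)$ are given by $n^+=\sum_{k\in\kappa^+}\lceil k/2\rceil+\sum_{k\in\kappa^-}\lfloor k/2\rfloor+\sum_{\ell\in\lambda}\ell$, $n^-=\sum_{k\in\kappa^+}\lfloor k/2\rfloor+\sum_{k\in\kappa^-}\lceil k/2\rceil+\sum_{\ell\in\lambda}\ell$. Bidegrees: $\mathrm{bdeg}\,p_{2k}^\pm=\mathrm{bdeg}\,q_k=(k,k)$, $\mathrm{bdeg}\,p_{2k+1}^+=(k+1,k)$,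 $\mathrm{bdeg}\,p_{2k+1}^-=(k,k+1)$; $p_\mu=\prod p_{k_i^+}^+\prod p_{k_i^-}^-\prod q_{\ell_i}$ has bidegree $(n^+(\mu),n^-(\mu))$. *)

theory Defs
  imports Complex_Main "HOL-Library.Multiset"
begin

text \<open>N+ = {0..<np} (vertices Inl a), N- = {0..<nm} (vertices Inr b).
  A state is given by its set of pairs (a,b), a in N+, b in N-; all other
  elements are singletons.\<close>

type_synonym state = "(nat \<times> nat) set"
type_synonym transition = "state \<times> state"
type_synonym vtx = "nat + nat"
type_synonym ttype = "nat multiset \<times> nat multiset \<times> nat multiset"

definition is_state :: "nat \<Rightarrow> nat \<Rightarrow> state \<Rightarrow> bool" where
  "is_state np nm s \<longleftrightarrow> s \<subseteq> {..<np} \<times> {..<nm}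
     \<and> (\<forall>a b b'. (a,b) \<in> s \<longrightarrow> (a,b') \<in> s \<longrightarrow> b = b')
     \<and> (\<forall>a a' b. (a,b) \<in> s \<longrightarrow> (a',b) \<in> s \<longrightarrow> a = a')"

definition states :: "nat \<Rightarrow> nat \<Rightarrow> state set" where
  "states np nm = {s. is_state np nm s}"

definition transitions :: "nat \<Rightarrow> nat \<Rightarrow> transition set" where
  "transitions np nm = states np nm \<times> states np nm"

definition is_transposition :: "nat \<Rightarrow> nat \<Rightarrow> transition \<Rightarrow> bool" where
  "is_transposition np nm t \<longleftrightarrow> (\<exists>a b. a < np \<and> b < nm \<and>
     (((a,b) \<notin> fst t \<and> snd t = insert (a,b) (fst t)) \<or>
      ((a,b) \<notin> snd t \<and> fst t = insert (a,b) (snd t))))"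

definition vertices :: "nat \<Rightarrow> nat \<Rightarrow> vtx set" where
  "vertices np nm = Inl ` {..<np} \<union> Inr ` {..<nm}"

definition edges :: "state \<Rightarrow> state \<Rightarrow> (vtx \<times> vtx) set" where
  "edges s s' = {(Inl a, Inr b) | a b. (a,b) \<in> s \<union> s'}"

definition comp :: "state \<Rightarrow> state \<Rightarrow> vtx \<Rightarrow> vtx set" where
  "comp s s' v = {w. (v,w) \<in> (edges s s' \<union> (edges s s')\<inverse>)\<^sup>*}"

definition comps :: "nat \<Rightarrow> nat \<Rightarrow> state \<Rightarrow> state \<Rightarrow> vtx set set" where
  "comps np nm s s' = comp s s' ` vertices np nm"

definition matched :: "state \<Rightarrow> vtx \<Rightarrow> bool" where
  "matched s v = (case v of Inl a \<Rightarrow> (\<exists>b. (a,b) \<in> s) | Inr b \<Rightarrow> (\<exists>a. (a,b) \<in> s))"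

text \<open>Degree in the multigraph with edges the pairs of s and of s'.\<close>
definition deg :: "state \<Rightarrow> state \<Rightarrow> vtx \<Rightarrow> nat" where
  "deg s s' v = (if matched s v then 1 else 0) + (if matched s' v then 1 else 0)"

definition is_cycle :: "state \<Rightarrow> state \<Rightarrow> vtx set \<Rightarrow> bool" where
  "is_cycle s s' C \<longleftrightarrow> (\<forall>v\<in>C. deg s s' v = 2)"

definition endpoints :: "state \<Rightarrow> state \<Rightarrow> vtx set \<Rightarrow> vtx set" where
  "endpoints s s' C = {v \<in> C. deg s s' v \<le> 1}"

definition plus_path :: "state \<Rightarrow> state \<Rightarrow> vtx set \<Rightarrow> bool" where
  "plus_path s s' C \<longleftrightarrow> \<not> is_cycle s s' C \<and>
     (if odd (card C) then (\<forall>v \<in> endpoints s s' C. isl v)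
      else (\<forall>v \<in> endpoints s s' C. \<not> matched s v))"

definition minus_path :: "state \<Rightarrow> state \<Rightarrow> vtx set \<Rightarrow> bool" where
  "minus_path s s' C \<longleftrightarrow> \<not> is_cycle s s' C \<and>
     (if odd (card C) then (\<forall>v \<in> endpoints s s' C. \<not> isl v)
      else (\<forall>v \<in> endpoints s s' C. \<not> matched s' v))"

definition type_of :: "nat \<Rightarrow> nat \<Rightarrow> transition \<Rightarrow> ttype" where
  "type_of np nm t = (let s = fst t; s' = snd t; M = mset_set (comps np nm s s') in
     (image_mset card (filter_mset (plus_path s s') M),
      image_mset card (filter_mset (minus_path s s') M),
      image_mset (\<lambda>C. card C div 2) (filter_mset (is_cycle s s') M)))"

definition nplus :: "ttype \<Rightarrow> nat" where
  "nplus \<mu> = (case \<mu> of (kp, km, l) \<Rightarrow>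
     sum_mset (image_mset (\<lambda>k. (k + 1) div 2) kp) + sum_mset (image_mset (\<lambda>k. k div 2) km) + sum_mset l)"

definition nminus :: "ttype \<Rightarrow> nat" where
  "nminus \<mu> = (case \<mu> of (kp, km, l) \<Rightarrow>
     sum_mset (image_mset (\<lambda>k. k div 2) kp) + sum_mset (image_mset (\<lambda>k. (k + 1) div 2) km) + sum_mset l)"

definition Types :: "nat \<Rightarrow> nat \<Rightarrow> ttype set" where
  "Types np nm = {(kp, km, l). (\<forall>k\<in>#kp. 1 \<le> k) \<and> (\<forall>k\<in>#km. 1 \<le> k) \<and> (\<forall>k\<in>#l. 1 \<le> k)
      \<and> nplus (kp, km, l) = np \<and> nminus (kp, km, l) = nm}"

definition tmul :: "nat \<Rightarrow> nat \<Rightarrow> (transition \<Rightarrow> rat) \<Rightarrow> (transition \<Rightarrow> rat) \<Rightarrow> transition \<Rightarrow> rat" where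
  "tmul np nm x y = (\<lambda>(s, s''). \<Sum>s'\<in>states np nm. x (s, s') * y (s', s''))"

definition Cmu :: "nat \<Rightarrow> nat \<Rightarrow> ttype \<Rightarrow> transition \<Rightarrow> rat" where
  "Cmu np nm \<mu> = (\<lambda>t. if t \<in> transitions np nm \<and> type_of np nm t = \<mu> then 1 else 0)"

definition cardC :: "nat \<Rightarrow> nat \<Rightarrow> ttype \<Rightarrow> nat" where
  "cardC np nm \<mu> = card {t \<in> transitions np nm. type_of np nm t = \<mu>}"

definition C2 :: "nat \<Rightarrow> nat \<Rightarrow> transition \<Rightarrow> rat" where
  "C2 np nm = (\<lambda>t. if t \<in> transitions np nm \<and> is_transposition np nm t then 1 else 0)"

text \<open>P True k = p_k^+, P False k = p_k^-, Q k = q_k. Monomials are multisets of variables;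
  polynomials are coefficient functions on monomials.\<close>
datatype var = P bool nat | Q nat

definition pmon :: "ttype \<Rightarrow> var multiset" where
  "pmon \<mu> = (case \<mu> of (kp, km, l) \<Rightarrow>
     image_mset (P True) kp + image_mset (P False) km + image_mset Q l)"

fun vidx :: "var \<Rightarrow> nat" where
  "vidx (P _ k) = k" | "vidx (Q k) = k"

definition wt :: "var multiset \<Rightarrow> nat" where
  "wt m = sum_mset (image_mset vidx m)"

definition ind :: "bool \<Rightarrow> rat" where
  "ind b = (if b then 1 else 0)"

definition bar :: "nat \<Rightarrow> bool" where
  "bar i = even i"

text \<open>Coefficient of the monomial m' in W^+|_{hbar=1} applied to the monomial m.
  All terms of the infinite sums over i,j \<ge> 1 with i > wt m or j > wt m vanish on m,
  so the sums are taken over {1..wt m}.\<close>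
definition Wcoef :: "var multiset \<Rightarrow> var multiset \<Rightarrow> rat" where
  "Wcoef m m' =
     (\<Sum>i\<in>{1..wt m}. \<Sum>j\<in>{1..wt m}.
        \<comment> \<open>p_i^{bar i} p_j^+ d/dp_{i+j}^{bar i}\<close>
        of_nat (count m (P (bar i) (i + j)))
          * ind (m' = m - {#P (bar i) (i + j)#} + {#P (bar i) i, P True j#})
        \<comment> \<open>p_{i+j}^{bar i} d^2/(dp_i^{bar i} dp_j^+)\<close>
      + of_nat (count m (P (bar i) i) * count (m - {#P (bar i) i#}) (P True j))
          * ind (m' = m - {#P (bar i) i#} - {#P True j#} + {#P (bar i) (i + j)#}))
   + (\<Sum>i\<in>{1..wt m}.
        \<comment> \<open>i p_{2i}^+ d/dq_i\<close>
        of_nat i * of_nat (count m (Q i))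
          * ind (m' = m - {#Q i#} + {#P True (2 * i)#})
        \<comment> \<open>q_i d/dp_{2i}^+\<close>
      + of_nat (count m (P True (2 * i)))
          * ind (m' = m - {#P True (2 * i)#} + {#Q i#}))"

end

theory Submission
  imports Defs
begin

text \<open>Orient the pairs of the initial state from N+ to N- and those of the final state from N- to N+.
  Every element then has at most one successor and at most one predecessor, so the components are
  directed paths and cycles along which the two sides alternate, and a path has sign + exactly when
  its last element lies in N+. Adding a pair to the initial state joins the last element (in N+) of
  a + path with j elements to the first element (in N-) of a path with i elements; the latter path
  has sign bar i and determines the sign of the result, and joining a path to itself closes a cycle.
  Removing a pair is the inverse move. Hence W+ counts the neighbours (s1, s'') of a fixed
  transition (s, s'') of type \<mu> by their type. Counting pairs of neighbouring transitions of types
  \<mu> and \<nu> in two ways then converts these numbers into the structure constants of the product with C2.\<close>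

section \<open>Components of an alternating partial injection\<close>

text \<open>Left multiplication leaves \<open>s''\<close> alone. Evaluating the product of
  \<open>C2\<close> with \<open>C_mu / |C_mu|\<close> at a transition of type \<open>\<nu>\<close>
  therefore gives \<open>Wcoef\<close> from \<open>\<nu>\<close> to \<open>\<mu>\<close>, divided by
  \<open>|C_mu|\<close>, while the operator asks for \<open>Wcoef\<close> from \<open>\<mu>\<close>
  to \<open>\<nu>\<close>, divided by \<open>|C_nu|\<close>. The double count says that
  \<open>Wcoef\<close> is symmetric after weighting by class sizes, which exchanges the two.
  Division by an empty class gives 0; that case is covered by a purely algebraic fact, the symmetry
  of the support of \<open>Wcoef\<close>. The coefficients arise as follows. A path with
  \<open>i + j\<close> elements and sign \<open>bar i\<close> has exactly one arc whose removal
  leaves \<open>i\<close> elements behind it, and parity forces this arc to leave N+. A cycle with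
  \<open>2i\<close> elements has \<open>i\<close> arcs leaving N+, hence the factor
  \<open>i\<close>. The second derivatives count ordered pairs of distinct paths. Labels are
  computed for joins only: a cut is a join read backwards.\<close>

definition cls :: "'a rel \<Rightarrow> 'a \<Rightarrow> 'a set" where
  "cls R v = (R \<union> R\<inverse>)\<^sup>* `` {v}"

lemma cls_refl [simp, intro]: "v \<in> cls R v"
  by (simp add: cls_def)

lemma cls_sym: "w \<in> cls R v \<Longrightarrow> v \<in> cls R w"
  using sym_rtrancl[OF sym_Un_converse[of R]] by (auto simp: cls_def dest: symD)

lemma cls_eq: "w \<in> cls R v \<Longrightarrow> cls R w = cls R v"
  using cls_sym[of w R v] by (auto simp: cls_def intro: rtrancl_trans)

lemma cls_edge: "(v, w) \<in> R \<Longrightarrow> cls R w = cls R v"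
  by (rule cls_eq) (auto simp: cls_def)

lemma cls_step: "u \<in> cls R v \<Longrightarrow> (u, w) \<in> R \<Longrightarrow> w \<in> cls R v"
  using cls_edge[of u w R] cls_eq[of u R v] by blast

lemma cls_step_back: "u \<in> cls R v \<Longrightarrow> (w, u) \<in> R \<Longrightarrow> w \<in> cls R v"
  using cls_edge[of w u R] cls_eq[of u R v] by blast

lemma cls_induct [consumes 1, case_names base fwd bwd]:
  assumes "w \<in> cls R v" "S v"
    and "\<And>u w. S u \<Longrightarrow> (u, w) \<in> R \<Longrightarrow> S w"
    and "\<And>u w. S u \<Longrightarrow> (w, u) \<in> R \<Longrightarrow> S w"
  shows "S w"
proof -
  have "(v, w) \<in> (R \<union> R\<inverse>)\<^sup>*" using assms(1) by (simp add: cls_def)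
  thus ?thesis
  proof (induction rule: rtrancl_induct)
    case (step u w)
    thus ?case using assms(3,4)[of u w] by blast
  qed (rule assms(2))
qed

lemma cls_mono: "R \<subseteq> R' \<Longrightarrow> cls R v \<subseteq> cls R' v"
  unfolding cls_def by (intro Image_mono rtrancl_mono) auto

text \<open>If \<open>x\<close> and \<open>y\<close> already share a class, the union collapses; so
  one formula serves both for linking two paths and for closing a path to a cycle.\<close>

lemma cls_insert:
  "cls (insert (x, y) R) v =
     (if v \<in> cls R x \<union> cls R y then cls R x \<union> cls R y else cls R v)"
proof (cases "v \<in> cls R x \<union> cls R y")
  case True
  let ?R = "insert (x, y) R"
  have sub: "cls ?R v \<subseteq> cls R x \<union> cls R y"
  proof
    fix w assume "w \<in> cls ?R v"
    thus "w \<in> cls R x \<union> cls R y"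
    proof (induction rule: cls_induct)
      case (fwd u w)
      thus ?case using cls_step[of u R _ w] by auto
    next
      case (bwd u w)
      thus ?case using cls_step_back[of u R _ w] by auto
    qed (rule True)
  qed
  have y: "cls ?R y = cls ?R x" by (rule cls_edge) simp
  have mono: "cls R x \<subseteq> cls ?R x" "cls R y \<subseteq> cls ?R x"
    using cls_mono[of R ?R x] cls_mono[of R ?R y] by (simp_all add: subset_insertI y)
  hence "v \<in> cls ?R x" using True by blast
  hence "cls ?R v = cls ?R x" by (rule cls_eq)
  thus ?thesis using True sub mono by simp blast
next
  case False
  have "w \<in> cls R v" if "w \<in> cls (insert (x, y) R) v" for w
    using that
  proof (induction rule: cls_induct)
    case (fwd u w)
    thus ?case using False cls_step[of u R v w] cls_sym[of u R v] by auto
  next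
    case (bwd u w)
    thus ?case using False cls_step_back[of u R v w] cls_sym[of u R v] by auto
  qed simp
  moreover have "cls R v \<subseteq> cls (insert (x, y) R) v" by (rule cls_mono) auto
  ultimately show ?thesis using False by auto
qed

lemma card_fst_eq_card_snd:
  assumes "single_valued R" "single_valued (R\<inverse>)" "E \<subseteq> R"
  shows "card (fst ` E) = card (snd ` E)"
proof -
  have "inj_on fst E" "inj_on snd E"
    using assms unfolding inj_on_def single_valued_def by (metis converse_iff prod.collapse subsetD)+
  thus ?thesis by (simp add: card_image)
qed

text \<open>Retains of a pair of states what cuts and joins preserve: a finite partial injection
  whose arcs change sides.\<close>

locale alternating_graph =
  fixes V :: "vtx set" and R :: "vtx rel"
  assumes finite_V: "finite V"
    and R_sub: "R \<subseteq> V \<times> V"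
    and sv: "single_valued R"
    and sv_conv: "single_valued (R\<inverse>)"
    and alternates: "(v, w) \<in> R \<Longrightarrow> isl v \<noteq> isl w"
begin

lemma finite_R: "finite R"
  using finite_subset[OF R_sub] finite_V by simp

lemma cls_sub: "v \<in> V \<Longrightarrow> cls R v \<subseteq> V"
proof
  fix w assume v: "v \<in> V" and "w \<in> cls R v"
  from this(2) show "w \<in> V"
  proof (induction rule: cls_induct)
    case base show ?case by (rule v)
  next
    case (fwd u w) show ?case using subsetD[OF R_sub fwd(2)] by simp
  next
    case (bwd u w) show ?case using subsetD[OF R_sub bwd(2)] by simp
  qed
qed

lemma finite_cls: "v \<in> V \<Longrightarrow> finite (cls R v)"
  using finite_subset[OF cls_sub finite_V] .

text \<open>Successors and predecessors are unique, so a walk that reverses its direction retraces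
  its last arc; cancelling such detours makes the walk directed.\<close>

lemma cls_linear: "w \<in> cls R v \<Longrightarrow> (v, w) \<in> R\<^sup>* \<or> (w, v) \<in> R\<^sup>*"
proof (induction rule: cls_induct)
  case (fwd u w)
  from fwd(1) show ?case
  proof
    assume "(u, v) \<in> R\<^sup>*"
    thus ?thesis using fwd(2) by (metis converse_rtranclE r_into_rtrancl single_valuedD sv)
  qed (use fwd(2) in \<open>blast intro: rtrancl_into_rtrancl\<close>)
next
  case (bwd u w)
  from bwd(1) show ?case
  proof
    assume "(v, u) \<in> R\<^sup>*"
    thus ?thesis using bwd(2) by (metis converse_iff r_into_rtrancl rtranclE single_valuedD sv_conv)
  qed (use bwd(2) in \<open>blast intro: converse_rtrancl_into_rtrancl\<close>)
qed simp

lemma rtrancl_cls: "(v, w) \<in> R\<^sup>* \<Longrightarrow> w \<in> cls R v"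
  unfolding cls_def by (auto intro: rtrancl_mono[THEN subsetD, rotated])

lemma end_unique:
  assumes "z \<in> cls R v" "z' \<in> cls R v" "z \<notin> Domain R" "z' \<notin> Domain R"
  shows "z = z'"
proof -
  have "z' \<in> cls R z" using assms cls_eq by metis
  from cls_linear[OF this] show ?thesis
    using assms(3,4) by (auto elim: converse_rtranclE)
qed

lemma start_unique:
  assumes "z \<in> cls R v" "z' \<in> cls R v" "z \<notin> Range R" "z' \<notin> Range R"
  shows "z = z'"
proof -
  have "z' \<in> cls R z" using assms cls_eq by metis
  from cls_linear[OF this] show ?thesis
    using assms(3,4) by (auto elim: rtranclE)
qed

text \<open>Both sides count the arcs with tail on side \<open>b\<close>, once by tails and once by
  heads; alternation puts the heads on the other side.\<close>

lemma card_Domain_Range: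
  "card {u \<in> cls R v. isl u = b \<and> u \<in> Domain R} = card {u \<in> cls R v. isl u \<noteq> b \<and> u \<in> Range R}"
proof -
  let ?E = "{(u, w) \<in> R. u \<in> cls R v \<and> isl u = b}"
  have "fst ` ?E = {u \<in> cls R v. isl u = b \<and> u \<in> Domain R}" by force
  moreover have "snd ` ?E = {u \<in> cls R v. isl u \<noteq> b \<and> u \<in> Range R}"
  proof (intro equalityI subsetI)
    fix w assume "w \<in> {u \<in> cls R v. isl u \<noteq> b \<and> u \<in> Range R}"
    then obtain u where "(u, w) \<in> R" "w \<in> cls R v" "isl w \<noteq> b" by auto
    thus "w \<in> snd ` ?E" using alternates[of u w] cls_step_back[of w R v u]
      by (intro image_eqI[of _ _ "(u, w)"]) auto
  next
    fix w assume "w \<in> snd ` ?E"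
    thus "w \<in> {u \<in> cls R v. isl u \<noteq> b \<and> u \<in> Range R}"
      using alternates cls_step[of _ R v] by auto
  qed
  ultimately show ?thesis using card_fst_eq_card_snd[OF sv sv_conv, of ?E] by auto
qed

lemma card_filter_split:
  assumes "v \<in> V"
  shows "card {u \<in> cls R v. isl u = b} =
           card {u \<in> cls R v. isl u = b \<and> u \<in> X} + card {u \<in> cls R v. isl u = b \<and> u \<notin> X}"
  using finite_cls[OF assms]
  by (subst card_Un_disjoint[symmetric]) (auto intro!: arg_cong[of _ _ card])

lemma card_split_isl:
  assumes "v \<in> V"
  shows "card (cls R v) = card {u \<in> cls R v. isl u} + card {u \<in> cls R v. \<not> isl u}"
  using finite_cls[OF assms]
  by (subst card_Un_disjoint[symmetric]) (auto intro!: arg_cong[of _ _ card])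

text \<open>Split each side of the component by \<open>card_filter_split\<close> and cancel the arcs
  leaving side \<open>b\<close>. The additive form avoids truncated subtraction.\<close>

lemma card_balance:
  assumes "v \<in> V"
  shows "card {u \<in> cls R v. isl u = b} + card {u \<in> cls R v. isl u \<noteq> b \<and> u \<notin> Range R} =
         card {u \<in> cls R v. isl u \<noteq> b} + card {u \<in> cls R v. isl u = b \<and> u \<notin> Domain R}"
  using card_filter_split[OF assms, of b "Domain R"]
    card_filter_split[OF assms, of "\<not> b" "Range R"] card_Domain_Range[of v b]
  by simp

text \<open>Adding the balances for both values of \<open>b\<close> cancels the elements, so a
  component has as many ends as starts. Finiteness enters here: an infinite ray would be a
  counterexample.\<close>

lemma Domain_iff_Range:
  assumes "v \<in> V"
  shows "cls R v \<subseteq> Domain R \<longleftrightarrow> cls R v \<subseteq> Range R"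
proof -
  let ?C = "cls R v"
  have "card {u \<in> ?C. isl u \<and> u \<notin> Domain R} + card {u \<in> ?C. \<not> isl u \<and> u \<notin> Domain R}
      = card {u \<in> ?C. isl u \<and> u \<notin> Range R} + card {u \<in> ?C. \<not> isl u \<and> u \<notin> Range R}"
    using card_balance[OF assms, of True] card_balance[OF assms, of False] by simp
  hence "(card {u \<in> ?C. isl u \<and> u \<notin> Domain R} = 0 \<and> card {u \<in> ?C. \<not> isl u \<and> u \<notin> Domain R} = 0)
      \<longleftrightarrow> (card {u \<in> ?C. isl u \<and> u \<notin> Range R} = 0 \<and> card {u \<in> ?C. \<not> isl u \<and> u \<notin> Range R} = 0)"
    by linarith
  thus ?thesis using finite_cls[OF assms] by (auto 0 3)
qed

lemma card_cycle:
  assumes "v \<in> V" "cls R v \<subseteq> Domain R"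
  shows "card {u \<in> cls R v. isl u} = card {u \<in> cls R v. \<not> isl u}"
proof -
  have "{u \<in> cls R v. isl u \<noteq> True \<and> u \<notin> Range R} = {}"
    "{u \<in> cls R v. isl u = True \<and> u \<notin> Domain R} = {}"
    using Domain_iff_Range[OF assms(1)] assms(2) by auto
  thus ?thesis using card_balance[OF assms(1), of True] by (simp only: card.empty) simp
qed

text \<open>Uniqueness of end and start reduces each correction term of \<open>card_balance\<close>
  to 0 or 1.\<close>

lemma card_path:
  assumes "v \<in> V" "z \<in> cls R v" "z \<notin> Domain R" "y \<in> cls R v" "y \<notin> Range R"
  shows "card {u \<in> cls R v. isl u} + of_bool (\<not> isl y)
           = card {u \<in> cls R v. \<not> isl u} + of_bool (isl z)"
proof -
  have "cls R v - Range R = {y}" using start_unique assms(4,5) by blast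
  hence "{u \<in> cls R v. isl u \<noteq> True \<and> u \<notin> Range R} = (if isl y then {} else {y})"
    by auto
  moreover have "cls R v - Domain R = {z}" using end_unique assms(2,3) by blast
  hence "{u \<in> cls R v. isl u = True \<and> u \<notin> Domain R} = (if isl z then {z} else {})"
    by auto
  ultimately show ?thesis using card_balance[OF assms(1), of True]
    by (simp split: if_splits)
qed

lemma even_card_path:
  assumes "v \<in> V" "z \<in> cls R v" "z \<notin> Domain R" "y \<in> cls R v" "y \<notin> Range R"
  shows "even (card (cls R v)) \<longleftrightarrow> isl y \<noteq> isl z"
proof -
  have parity: "a + of_bool (\<not> p) = b + of_bool q \<Longrightarrow> even (a + b) \<longleftrightarrow> p \<noteq> q" for a b :: nat and p q
    by (cases p; cases q; simp; presburger)
  show ?thesis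
    unfolding card_split_isl[OF assms(1)] by (rule parity) (rule card_path[OF assms])
qed

lemma path_ends:
  assumes "v \<in> V" "\<not> cls R v \<subseteq> Domain R"
  obtains z y where "z \<in> cls R v" "z \<notin> Domain R" "y \<in> cls R v" "y \<notin> Range R"
  using assms Domain_iff_Range by blast

end

text \<open>On a component that is not a cycle, the quantifier ranges over a single element, the last one
  of the path.\<close>

definition lab :: "vtx rel \<Rightarrow> vtx set \<Rightarrow> var" where
  "lab R C = (if C \<subseteq> Domain R then Q (card C div 2)
              else P (\<forall>z\<in>C - Domain R. isl z) (card C))"

text \<open>One multiset of variables instead of a triple: each move becomes a replacement inside a
  monomial, the form in which \<open>Wcoef\<close> is stated.\<close>

definition mon :: "vtx set \<Rightarrow> vtx rel \<Rightarrow> var multiset" where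
  "mon V R = image_mset (lab R) (mset_set (cls R ` V))"

lemma count_image_mset_set:
  "finite K \<Longrightarrow> count (image_mset f (mset_set K)) a = card {C \<in> K. f C = a}"
  by (auto simp: count_image_mset vimage_def Int_def conj_commute)

lemma cls_image_disjoint:
  "C \<in> cls R ` V \<Longrightarrow> v \<in> C \<Longrightarrow> C = cls R v"
  by (auto dest: cls_eq)

section \<open>Labels of paths and their two ends\<close>

context alternating_graph
begin

lemma cls_end:
  assumes "v \<in> V" "z \<in> cls R v" "z \<notin> Domain R"
  shows "cls R v - Domain R = {z}"
  using assms end_unique by blast

lemma lab_path:
  assumes "v \<in> V" "z \<in> cls R v" "z \<notin> Domain R"
  shows "lab R (cls R v) = P (isl z) (card (cls R v))"
  using assms cls_end[OF assms] by (auto simp: lab_def)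

text \<open>Sides alternate, so a path starting in N- ends in N+ exactly when its number of elements
  is even. This is the origin of \<open>bar\<close>.\<close>

lemma lab_start:
  assumes "v \<in> V" "y \<in> cls R v" "y \<notin> Range R" "\<not> isl y"
  shows "lab R (cls R v) = P (bar (card (cls R v))) (card (cls R v))"
proof -
  obtain z where z: "z \<in> cls R v" "z \<notin> Domain R"
    using Domain_iff_Range[OF assms(1)] assms(2,3) by auto
  have "isl z = even (card (cls R v))"
    using even_card_path[OF assms(1) z assms(2,3)] assms(4) by simp
  thus ?thesis using lab_path[OF assms(1) z] by (simp add: bar_def)
qed

lemma lab_start_conv:
  assumes "v \<in> V" "lab R (cls R v) = P (bar i) i"
  obtains y where "y \<in> cls R v" "y \<notin> Range R" "\<not> isl y" "card (cls R v) = i"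
proof -
  have "\<not> cls R v \<subseteq> Domain R" using assms(2) by (auto simp: lab_def)
  then obtain z y where *: "z \<in> cls R v" "z \<notin> Domain R" "y \<in> cls R v" "y \<notin> Range R"
    using path_ends assms(1) by metis
  have i: "card (cls R v) = i" "isl z = even i"
    using assms(2) lab_path[OF assms(1) *(1,2)] by (auto simp: bar_def)
  have "\<not> isl y"
    using even_card_path[OF assms(1) *] i by auto
  thus ?thesis using that * i by blast
qed

lemma lab_end_conv:
  assumes "v \<in> V" "lab R (cls R v) = P True j"
  obtains x where "x \<in> cls R v" "x \<notin> Domain R" "isl x" "card (cls R v) = j"
proof -
  have "\<not> cls R v \<subseteq> Domain R" using assms(2) by (auto simp: lab_def)
  then obtain z where *: "z \<in> cls R v" "z \<notin> Domain R" by auto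
  thus ?thesis using that assms lab_path[OF assms(1) *] by auto
qed

lemma card_cls_pos: "v \<in> V \<Longrightarrow> 1 \<le> card (cls R v)"
  using finite_cls[of v] by (simp add: Suc_le_eq card_gt_0_iff) (metis cls_refl empty_iff)

lemma finite_comps: "finite (cls R ` V)"
  using finite_V by simp

lemma count_mon: "count (mon V R) a = card {C \<in> cls R ` V. lab R C = a}"
  unfolding mon_def by (rule count_image_mset_set[OF finite_comps])

end

text \<open>For \<open>R = arcs s s'\<close> the conditions say that \<open>x\<close> in N+ and
  \<open>y\<close> in N- are singletons of \<open>s\<close>, so that the pair can be added to
  \<open>s\<close>.\<close>

locale join = alternating_graph +
  fixes x y :: vtx
  assumes xV: "x \<in> V" and yV: "y \<in> V" and isl_x: "isl x" and isr_y: "\<not> isl y"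
    and x_end: "x \<notin> Domain R" and y_start: "y \<notin> Range R"
begin

sublocale joined: alternating_graph V "insert (x, y) R"
proof
  show "single_valued (insert (x, y) R)" "single_valued ((insert (x, y) R)\<inverse>)"
    using sv sv_conv x_end y_start by (auto simp: single_valued_def)
qed (use finite_V R_sub xV yV isl_x isr_y alternates in auto)

lemma joined_comps:
  "cls (insert (x, y) R) ` V = insert (cls R x \<union> cls R y) (cls R ` V - {cls R x, cls R y})"
proof -
  have "v \<in> cls R x \<union> cls R y \<longleftrightarrow> cls R v \<in> {cls R x, cls R y}" for v
    using cls_eq[of v R] cls_refl[of v R] by auto
  thus ?thesis using xV by (auto simp: cls_insert)
qed

text \<open>The domain grows by \<open>x\<close> alone, so every component avoiding \<open>x\<close>
  keeps its label.\<close>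

lemma mon_joined:
  "mon V (insert (x, y) R) =
     add_mset (lab (insert (x, y) R) (cls R x \<union> cls R y))
       (image_mset (lab R) (mset_set (cls R ` V - {cls R x, cls R y})))"
proof -
  let ?K = "cls R ` V - {cls R x, cls R y}"
  have "cls R x \<union> cls R y \<notin> ?K"
    using cls_image_disjoint[of _ R V x] by blast
  moreover have "lab (insert (x, y) R) D = lab R D" if "D \<in> ?K" for D
  proof -
    have "x \<notin> D" using that cls_image_disjoint[of D R V x] by blast
    hence "D - Domain (insert (x, y) R) = D - Domain R"
      "D \<subseteq> Domain (insert (x, y) R) \<longleftrightarrow> D \<subseteq> Domain R" by auto
    thus ?thesis unfolding lab_def by presburger
  qed
  ultimately show ?thesis
    unfolding mon_def joined_comps using finite_comps
    by simp (rule image_mset_cong, simp)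
qed

lemma lab_x: "lab R (cls R x) = P True (card (cls R x))"
  using lab_path[OF xV cls_refl x_end] isl_x by simp

lemma lab_y: "lab R (cls R y) = P (bar (card (cls R y))) (card (cls R y))"
  using lab_start[OF yV cls_refl y_start isr_y] .

text \<open>The joined path ends where the path of \<open>y\<close> ended and inherits its sign. The
  additive multiset equation can be solved for either monomial, so it serves the join and its
  inverse.\<close>

lemma join_distinct:
  assumes "cls R x \<noteq> cls R y"
  defines "i \<equiv> card (cls R y)" and "j \<equiv> card (cls R x)"
  shows "cls (insert (x, y) R) x = cls R x \<union> cls R y"
    and "lab (insert (x, y) R) (cls (insert (x, y) R) x) = P (bar i) (i + j)"
    and "mon V (insert (x, y) R) + {#P (bar i) i, P True j#} = mon V R + {#P (bar i) (i + j)#}"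
proof -
  let ?R = "insert (x, y) R"
  show c: "cls ?R x = cls R x \<union> cls R y" by (simp add: cls_insert)
  have disj: "cls R x \<inter> cls R y = {}" using assms(1) cls_eq by (metis disjoint_iff)
  obtain z where z: "z \<in> cls R y" "z \<notin> Domain R"
    using Domain_iff_Range[OF yV] y_start by auto
  have "z \<notin> Domain ?R" using z disj by auto
  from joined.lab_path[OF xV _ this] z
  have "lab ?R (cls ?R x) = P (isl z) (card (cls R x \<union> cls R y))" by (simp add: c)
  also have "card (cls R x \<union> cls R y) = i + j"
    using disj finite_cls xV yV by (simp add: card_Un_disjoint i_def j_def)
  also have "isl z = bar i" using lab_path[OF yV z] lab_y by (simp add: i_def)
  finally show l: "lab ?R (cls ?R x) = P (bar i) (i + j)" .
  have "cls R ` V = insert (cls R x) (insert (cls R y) (cls R ` V - {cls R x, cls R y}))"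
    using xV yV by auto
  hence "mset_set (cls R ` V) = add_mset (cls R x) (add_mset (cls R y)
           (mset_set (cls R ` V - {cls R x, cls R y})))"
    using assms(1) finite_comps by (metis (no_types, lifting) Diff_iff finite_Diff finite_insert insertE insert_iff mset_set.insert)
  hence "mon V R = add_mset (P True j) (add_mset (P (bar i) i)
           (image_mset (lab R) (mset_set (cls R ` V - {cls R x, cls R y}))))"
    by (simp add: mon_def lab_x lab_y i_def j_def)
  thus "mon V ?R + {#P (bar i) i, P True j#} = mon V R + {#P (bar i) (i + j)#}"
    using l mon_joined by (simp add: c)
qed

lemma join_same:
  assumes "cls R x = cls R y"
  defines "i \<equiv> card (cls R x) div 2"
  shows "cls (insert (x, y) R) x = cls R x"
    and "card (cls R x) = 2 * i"
    and "lab (insert (x, y) R) (cls R x) = Q i"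
    and "mon V (insert (x, y) R) + {#P True (2 * i)#} = mon V R + {#Q i#}"
proof -
  let ?R = "insert (x, y) R"
  show "cls ?R x = cls R x" using assms(1) by (simp add: cls_insert)
  \<comment> \<open>The same path has sign + by its end \<open>x\<close> and sign \<open>bar\<close>
    of its size by its start \<open>y\<close>; hence the size is even.\<close>
  show i: "card (cls R x) = 2 * i" using lab_x lab_y assms by (simp add: bar_def)
  have "cls R x \<subseteq> Domain ?R" using cls_end[OF xV cls_refl x_end] by auto
  thus l: "lab ?R (cls R x) = Q i" by (simp add: lab_def i_def)
  have "mset_set (cls R ` V) = add_mset (cls R x) (mset_set (cls R ` V - {cls R x}))"
    using mset_set.remove[OF finite_comps, of "cls R x"] xV by simp
  hence "mon V R = add_mset (P True (2 * i)) (image_mset (lab R) (mset_set (cls R ` V - {cls R x})))"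
    by (simp add: mon_def lab_x i)
  thus "mon V ?R + {#P True (2 * i)#} = mon V R + {#Q i#}"
    using l mon_joined assms(1) by simp
qed

end

section \<open>Cutting an arc\<close>

context alternating_graph
begin

text \<open>Deleting an arc that leaves N+ turns its tail into an end and its head into a start, so
  \<open>R\<close> is itself a join of the smaller graph and the label computations for joins apply
  to cuts.\<close>

lemma join_cut:
  assumes "(x, y) \<in> R" "isl x"
  shows "join V (R - {(x, y)}) x y"
proof
  show "single_valued (R - {(x, y)})" "single_valued ((R - {(x, y)})\<inverse>)"
    using sv sv_conv by (auto simp: single_valued_def)
  show "x \<notin> Domain (R - {(x, y)})" "y \<notin> Range (R - {(x, y)})"
    using assms sv sv_conv by (auto simp: single_valued_def)
qed (use finite_V R_sub assms alternates in auto)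

text \<open>The forward orbit of an element on a closed walk never leaves that walk; here it
  contains the end of the path, which has no successor.\<close>

lemma path_acyclic:
  assumes "v \<in> V" "\<not> cls R v \<subseteq> Domain R" "w \<in> cls R v"
  shows "(w, w) \<notin> R\<^sup>+"
proof
  assume w: "(w, w) \<in> R\<^sup>+"
  obtain z where z: "z \<in> cls R v" "z \<notin> Domain R" using assms by auto
  have "z \<in> cls R w" using z assms(3) cls_eq by metis
  with z(2) have "(w, z) \<in> R\<^sup>*"
    using cls_linear[of z w] by (auto elim: converse_rtranclE)
  hence "(z, z) \<in> R\<^sup>+"
  proof (induction rule: rtrancl_induct)
    case (step u u')
    then obtain u'' where "(u, u'') \<in> R" "(u'', u) \<in> R\<^sup>*" by (auto dest: tranclD)
    with step(2) show ?case using sv by (metis rtrancl_into_trancl1 single_valuedD)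
  qed (rule w)
  thus False using z(2) by (auto dest: tranclD)
qed

text \<open>After the cut \<open>y\<close> has no predecessor, so a backward step from the orbit of
  \<open>y\<close> stays inside it; and the orbit never uses the deleted arc, as it does not reach
  \<open>x\<close>.\<close>

lemma cls_cut:
  assumes "(x, y) \<in> R" "(y, x) \<notin> R\<^sup>*"
  shows "cls (R - {(x, y)}) y = R\<^sup>* `` {y}"
proof (intro equalityI subsetI)
  let ?R = "R - {(x, y)}"
  fix w assume "w \<in> cls ?R y"
  thus "w \<in> R\<^sup>* `` {y}"
  proof (induction rule: cls_induct)
    case (fwd u w)
    thus ?case by (auto intro: rtrancl_into_rtrancl)
  next
    case (bwd u w)
    from bwd(1) have "(y, u) \<in> R\<^sup>*" by simp
    thus ?case
    proof (cases rule: rtranclE)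
      case base
      thus ?thesis using bwd(2) assms(1) sv_conv by (auto simp: single_valued_def)
    next
      case (step u')
      thus ?thesis using bwd(2) sv_conv by (auto simp: single_valued_def)
    qed
  qed simp
next
  fix w assume "w \<in> R\<^sup>* `` {y}"
  hence "(y, w) \<in> R\<^sup>*" by simp
  thus "w \<in> cls (R - {(x, y)}) y"
  proof (induction rule: rtrancl_induct)
    case (step u u')
    hence "(u, u') \<in> R - {(x, y)}" using assms(2) by auto
    thus ?case using step.IH by (rule cls_step[rotated])
  qed simp
qed

text \<open>Forward orbits shrink strictly along a path, so their sizes tell the arcs apart;
  surjectivity then follows by counting. Arcs of both directions occur here; the restriction to
  those leaving N+ comes later, by parity.\<close>

lemma bij_betw_cut:
  assumes "v \<in> V" "\<not> cls R v \<subseteq> Domain R"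
  shows "bij_betw (\<lambda>(x, y). card (cls (R - {(x, y)}) y)) {(x, y) \<in> R. x \<in> cls R v}
           {1..<card (cls R v)}"
proof -
  let ?C = "cls R v" and ?E = "{(x, y) \<in> R. x \<in> cls R v}"
  let ?f = "\<lambda>(x, y). card (cls (R - {(x, y)}) y)"
  obtain z where z: "z \<in> ?C" "z \<notin> Domain R" using assms by auto
  have E: "y \<in> ?C" "x \<in> ?C" "(y, x) \<notin> R\<^sup>*" if "(x, y) \<in> ?E" for x y
  proof -
    show "x \<in> ?C" "y \<in> ?C" using that by (auto intro: cls_step)
    show "(y, x) \<notin> R\<^sup>*"
      using path_acyclic[OF assms \<open>y \<in> ?C\<close>] that by (auto intro: rtrancl_into_trancl1)
  qed
  have f: "?f (x, y) = card (R\<^sup>* `` {y})" if "(x, y) \<in> ?E" for x y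
    using cls_cut[of x y] E[OF that] that by simp
  have orbit: "R\<^sup>* `` {y} \<subseteq> ?C" if "y \<in> ?C" for y
    using rtrancl_cls cls_eq[OF that] by blast
  have less: "card (R\<^sup>* `` {y'}) < card (R\<^sup>* `` {y})"
    if "(y, y') \<in> R\<^sup>*" "y \<noteq> y'" "y \<in> ?C" for y y'
  proof (rule psubset_card_mono)
    show "finite (R\<^sup>* `` {y})" using orbit[OF that(3)] finite_cls[OF assms(1)] finite_subset by blast
    have "(y', y) \<notin> R\<^sup>*"
      using that path_acyclic[OF assms that(3)] by (metis rtrancl_trancl_trancl rtranclD)
    thus "R\<^sup>* `` {y'} \<subset> R\<^sup>* `` {y}" using that(1) by (auto intro: rtrancl_trans)
  qed
  have "inj_on ?f ?E"
  proof (rule inj_onI, clarify)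
    fix x y x' y'
    assume *: "(x, y) \<in> R" "x \<in> ?C" "(x', y') \<in> R" "x' \<in> ?C"
      and eq: "card (cls (R - {(x, y)}) y) = card (cls (R - {(x', y')}) y')"
    have yC: "y \<in> ?C" "y' \<in> ?C" using * cls_step by metis+
    have "y' \<in> cls R y" using yC cls_eq by metis
    hence "y = y'" using cls_linear[of y' y] less[of y y'] less[of y' y] yC f[of x y] f[of x' y'] eq *
      by fastforce
    thus "x = x' \<and> y = y'" using * sv_conv by (auto simp: single_valued_def)
  qed
  moreover have "?f ` ?E \<subseteq> {1..<card ?C}"
  proof (clarify)
    fix x y assume *: "(x, y) \<in> R" "x \<in> ?C"
    hence xy: "(x, y) \<in> ?E" by simp
    have "R\<^sup>* `` {y} \<subset> ?C" using E[OF xy] orbit by blast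
    hence "card (R\<^sup>* `` {y}) < card ?C" "finite (R\<^sup>* `` {y})"
      using finite_cls[OF assms(1)] by (auto intro: psubset_card_mono finite_subset)
    moreover have "card (R\<^sup>* `` {y}) > 0" using calculation(2) by (auto simp: card_gt_0_iff)
    ultimately show "card (cls (R - {(x, y)}) y) \<in> {1..<card ?C}" using f[OF xy] by simp
  qed
  \<comment> \<open>Every element except the end \<open>z\<close> has exactly one outgoing
    arc.\<close>
  moreover have "card ?E = card {1..<card ?C}"
  proof -
    have "inj_on fst ?E" using sv by (auto simp: inj_on_def single_valued_def)
    hence "card ?E = card (fst ` ?E)" by (rule card_image[symmetric])
    also have "fst ` ?E = ?C \<inter> Domain R" by force
    also have "\<dots> = ?C - {z}" using cls_end[OF assms(1) z] by blast
    finally have "card ?E = card (?C - {z})" .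
    thus ?thesis using z finite_cls[OF assms(1)] by simp
  qed
  ultimately show ?thesis
    unfolding bij_betw_def
    by (intro conjI card_subset_eq finite_atLeastLessThan) (simp_all only: card_image)
qed

end

section \<open>Counting cuts and joins\<close>

lemma sum_fiber:
  fixes f :: "'b \<Rightarrow> 'c::semiring_1"
  assumes "finite S" "finite T" "g ` S \<subseteq> T"
  shows "(\<Sum>e\<in>S. f (g e)) = (\<Sum>t\<in>T. of_nat (card {e \<in> S. g e = t}) * f t)"
proof -
  have "(\<Sum>e\<in>S. f (g e)) = (\<Sum>t\<in>T. \<Sum>e\<in>{e \<in> S. g e = t}. f (g e))"
    using sum.group[OF assms, of "\<lambda>e. f (g e)"] by simp
  also have "\<dots> = (\<Sum>t\<in>T. of_nat (card {e \<in> S. g e = t}) * f t)"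
    by (intro sum.cong refl) simp
  finally show ?thesis .
qed

text \<open>For \<open>a = b\<close> this is the falling factorial produced by a second derivative
  in one variable. It occurs in W+ when \<open>i = j\<close> is even, where both derivatives are
  taken in the same variable.\<close>

lemma card_distinct_pairs:
  assumes "finite K"
  shows "card {p \<in> {C \<in> K. f C = a} \<times> {C \<in> K. f C = b}. fst p \<noteq> snd p} =
         count (image_mset f (mset_set K)) b * count (image_mset f (mset_set K) - {#b#}) a"
proof (cases "a = b")
  case False
  hence "{p \<in> {C \<in> K. f C = a} \<times> {C \<in> K. f C = b}. fst p \<noteq> snd p} =
      {C \<in> K. f C = a} \<times> {C \<in> K. f C = b}" by auto
  thus ?thesis using False by (simp add: card_cartesian_product count_image_mset_set assms)
next
  case True
  let ?U = "{C \<in> K. f C = b}"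
  have U: "finite ?U" using assms by simp
  have diag: "p \<in> (\<lambda>C. (C, C)) ` ?U \<longleftrightarrow> p \<in> ?U \<times> ?U \<and> fst p = snd p" for p
    by (cases p) (auto simp: image_iff)
  have "{p \<in> ?U \<times> ?U. fst p \<noteq> snd p} = ?U \<times> ?U - (\<lambda>C. (C, C)) ` ?U"
    unfolding set_eq_iff Diff_iff diag by blast
  moreover have "card (?U \<times> ?U - (\<lambda>C. (C, C)) ` ?U) = card (?U \<times> ?U) - card ((\<lambda>C. (C, C)) ` ?U)"
    using U by (intro card_Diff_subset) auto
  moreover have "card ((\<lambda>C. (C, C)) ` ?U) = card ?U" by (rule card_image) (simp add: inj_on_def)
  ultimately show ?thesis using True
    by (simp add: card_cartesian_product count_image_mset_set assms diff_mult_distrib2)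
qed

lemma vidx_le_wt: "a \<in># m \<Longrightarrow> vidx a \<le> wt m"
  unfolding wt_def by (metis add_left_mono image_mset_add_mset le_add1 multi_member_split sum_mset.insert)

context alternating_graph
begin

lemma alternating_cut: "alternating_graph V (R - {e})"
proof
  show "single_valued (R - {e})" "single_valued ((R - {e})\<inverse>)"
    using sv sv_conv by (auto simp: single_valued_def)
qed (use finite_V R_sub alternates in auto)

lemma lab_in_mon: "v \<in> V \<Longrightarrow> lab R (cls R v) \<in># mon V R"
  using finite_V by (auto simp: mon_def)

lemma cut_distinct:
  assumes "e \<in> R" "isl (fst e)" "cls (R - {e}) (fst e) \<noteq> cls (R - {e}) (snd e)"
  defines "i \<equiv> card (cls (R - {e}) (snd e))" and "j \<equiv> card (cls (R - {e}) (fst e))"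
  shows "1 \<le> i" "1 \<le> j" "lab R (cls R (fst e)) = P (bar i) (i + j)"
    "mon V (R - {e}) = mon V R - {#P (bar i) (i + j)#} + {#P (bar i) i, P True j#}"
proof -
  obtain x y where e: "e = (x, y)" by (cases e)
  interpret J: join V "R - {e}" x y using join_cut[of x y] assms by (simp add: e)
  have R: "insert (x, y) (R - {e}) = R" using assms(1) e by auto
  show "1 \<le> i" "1 \<le> j" using J.card_cls_pos J.xV J.yV by (simp_all add: i_def j_def e)
  have d: "cls (R - {e}) x \<noteq> cls (R - {e}) y" using assms(3) e by simp
  note J.join_distinct[OF d, unfolded R]
  thus l: "lab R (cls R (fst e)) = P (bar i) (i + j)" by (simp add: i_def j_def e)
  have "mon V R + {#P (bar i) i, P True j#} = mon V (R - {e}) + {#P (bar i) (i + j)#}"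
    using J.join_distinct(3)[OF d, unfolded R] by (simp add: i_def j_def e)
  \<comment> \<open>Membership is what allows the removed variable to be subtracted before the new
    ones are added.\<close>
  moreover have "P (bar i) (i + j) \<in># mon V R"
    using lab_in_mon[OF J.xV] l by (simp add: e)
  ultimately show "mon V (R - {e}) = mon V R - {#P (bar i) (i + j)#} + {#P (bar i) i, P True j#}"
    by (metis add_diff_cancel_right' multiset_diff_union_assoc single_subset_iff subset_mset.add_diff_assoc2)
qed

lemma cut_same:
  assumes "e \<in> R" "isl (fst e)" "cls (R - {e}) (fst e) = cls (R - {e}) (snd e)"
  defines "i \<equiv> card (cls (R - {e}) (fst e)) div 2"
  shows "1 \<le> i" "lab R (cls R (fst e)) = Q i"
    "mon V (R - {e}) = mon V R - {#Q i#} + {#P True (2 * i)#}"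
proof -
  obtain x y where e: "e = (x, y)" by (cases e)
  interpret J: join V "R - {e}" x y using join_cut[of x y] assms by (simp add: e)
  have R: "insert (x, y) (R - {e}) = R" using assms(1) e by auto
  have s: "cls (R - {e}) x = cls (R - {e}) y" using assms(3) e by simp
  note J = J.join_same[OF s, unfolded R]
  show "1 \<le> i" using J.card_cls_pos[OF J.xV] J(2) by (simp add: i_def e)
  show l: "lab R (cls R (fst e)) = Q i" using J(1,3) by (simp add: i_def e)
  have "mon V R + {#P True (2 * i)#} = mon V (R - {e}) + {#Q i#}"
    using J(4) by (simp add: i_def e)
  moreover have "Q i \<in># mon V R"
    using lab_in_mon[OF J.xV] l by (simp add: e)
  ultimately show "mon V (R - {e}) = mon V R - {#Q i#} + {#P True (2 * i)#}"
    by (metis add_diff_cancel_right' multiset_diff_union_assoc single_subset_iff subset_mset.add_diff_assoc2)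
qed

text \<open>Each path with label \<open>P (bar i) (i + j)\<close> contributes one arc:
  \<open>bij_betw_cut\<close> supplies the arc with \<open>i\<close> elements behind it, and the
  sign \<open>bar i\<close> forces its tail into N+.\<close>

lemma card_cut_distinct:
  assumes "1 \<le> i" "1 \<le> j"
  shows "card {e \<in> R. isl (fst e) \<and> cls (R - {e}) (fst e) \<noteq> cls (R - {e}) (snd e) \<and>
                 card (cls (R - {e}) (snd e)) = i \<and> card (cls (R - {e}) (fst e)) = j}
         = count (mon V R) (P (bar i) (i + j))" (is "card ?S = _")
proof -
  let ?T = "{C \<in> cls R ` V. lab R C = P (bar i) (i + j)}"
  have "bij_betw (\<lambda>e. cls R (fst e)) ?S ?T"
  proof (rule bij_betwI')
    fix e e' assume e: "e \<in> ?S" and e': "e' \<in> ?S"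
    have V: "fst e \<in> V" using e R_sub by auto
    have "lab R (cls R (fst e)) = P (bar i) (i + j)" using cut_distinct(3)[of e] e by simp
    hence "\<not> cls R (fst e) \<subseteq> Domain R" by (auto simp: lab_def)
    note inj = bij_betw_imp_inj_on[OF bij_betw_cut[OF V this]]
    show "cls R (fst e) = cls R (fst e') \<longleftrightarrow> e = e'"
    proof
      assume eq: "cls R (fst e) = cls R (fst e')"
      have "fst e' \<in> cls R (fst e)" unfolding eq by simp
      thus "e = e'" using inj_onD[OF inj, of e e'] e e' by (simp add: case_prod_beta)
    qed simp
  next
    fix e assume e: "e \<in> ?S"
    have "fst e \<in> V" using e R_sub by auto
    thus "cls R (fst e) \<in> ?T" using cut_distinct(3)[of e] e by simp
  next
    fix C assume "C \<in> ?T"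
    then obtain v where v: "v \<in> V" and C: "C = cls R v" and l: "lab R C = P (bar i) (i + j)" by auto
    have nc: "\<not> cls R v \<subseteq> Domain R" using l C by (auto simp: lab_def)
    then obtain z where z: "z \<in> cls R v" "z \<notin> Domain R" by auto
    have lz: "isl z = even i" "card (cls R v) = i + j"
      using l C lab_path[OF v z] by (auto simp: bar_def)
    hence "i \<in> {1..<card (cls R v)}" using assms by simp
    hence "i \<in> (\<lambda>(x, y). card (cls (R - {(x, y)}) y)) ` {(x, y) \<in> R. x \<in> cls R v}"
      by (simp only: bij_betw_imp_surj_on[OF bij_betw_cut[OF v nc]])
    then obtain x y where xy: "(x, y) \<in> R" "x \<in> cls R v" "card (cls (R - {(x, y)}) y) = i"
      by (elim imageE) (simp split: prod.splits, blast)
    have yv: "y \<in> cls R v" using xy cls_step by metis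
    have yx: "(y, x) \<notin> R\<^sup>*"
      using path_acyclic[OF v nc yv] xy(1) by (auto intro: rtrancl_into_trancl1)
    interpret R0: alternating_graph V "R - {(x, y)}" by (rule alternating_cut)
    have "z \<in> cls R y" using z(1) yv cls_eq by metis
    hence "(y, z) \<in> R\<^sup>*" using cls_linear[of z y] z(2) by (auto elim: converse_rtranclE)
    hence zy: "z \<in> cls (R - {(x, y)}) y" by (simp add: cls_cut[OF xy(1) yx])
    have "y \<notin> Range (R - {(x, y)})" using sv_conv xy(1) by (auto simp: single_valued_def)
    moreover have "y \<in> V" "z \<notin> Domain (R - {(x, y)})" using xy(1) R_sub z by auto
    \<comment> \<open>The rear part runs from \<open>y\<close> to the old end \<open>z\<close> and
      has \<open>i\<close> elements. Since \<open>z\<close> lies in N+ iff \<open>i\<close> is even,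
      \<open>y\<close> must lie in N-.\<close>
    ultimately have "isl y \<noteq> isl z \<longleftrightarrow> even i"
      using R0.even_card_path[of y z y] zy xy(3) by simp
    hence "\<not> isl y" using lz by auto
    hence x: "isl x" using alternates[OF xy(1)] by simp
    have Cx: "cls R x = C" using xy(2) C cls_eq by metis
    \<comment> \<open>Otherwise the uncut component would be a cycle and its label a
      \<open>Q\<close>.\<close>
    have d: "cls (R - {(x, y)}) x \<noteq> cls (R - {(x, y)}) y"
      using cut_same(2)[of "(x, y)"] xy(1) x l Cx by auto
    hence "card (cls (R - {(x, y)}) x) = j"
      using cut_distinct(3)[of "(x, y)"] xy x l Cx by auto
    thus "\<exists>e\<in>?S. C = cls R (fst e)"
      using xy x d Cx by (intro bexI[of _ "(x, y)"]) auto
  qed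
  thus ?thesis by (simp add: count_mon bij_betw_same_card)
qed

text \<open>A cycle of half-length \<open>i\<close> has \<open>i\<close> elements in N+, each the
  tail of one arc, and every such cut yields the same monomial. This is the coefficient of
  \<open>p_{2i}^+ d/dq_i\<close>.\<close>

lemma card_cut_same:
  "card {e \<in> R. isl (fst e) \<and> cls (R - {e}) (fst e) = cls (R - {e}) (snd e) \<and>
           card (cls (R - {e}) (fst e)) div 2 = i} = i * count (mon V R) (Q i)" (is "card ?S = _")
proof -
  let ?K = "{C \<in> cls R ` V. lab R C = Q i}"
  let ?E = "\<lambda>C. {e \<in> R. isl (fst e) \<and> fst e \<in> C}"
  have S: "?S = (\<Union>C\<in>?K. ?E C)"
  proof (intro equalityI subsetI)
    fix e assume e: "e \<in> ?S"
    moreover have "fst e \<in> V" using e R_sub by auto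
    ultimately show "e \<in> (\<Union>C\<in>?K. ?E C)" using cut_same(2)[of e] by auto
  next
    fix e assume "e \<in> (\<Union>C\<in>?K. ?E C)"
    then obtain C where C: "C \<in> cls R ` V" "lab R C = Q i" "e \<in> R" "isl (fst e)" "fst e \<in> C" by auto
    have "lab R (cls R (fst e)) = Q i" using cls_image_disjoint[OF C(1,5)] C(2) by simp
    moreover from this have "cls (R - {e}) (fst e) = cls (R - {e}) (snd e)"
      using cut_distinct(3)[of e] C by fastforce
    ultimately show "e \<in> ?S" using cut_same(2)[of e] C by simp
  qed
  have "card (?E C) = i" if "C \<in> ?K" for C
  proof -
    from that obtain v where v: "v \<in> V" "C = cls R v" "lab R C = Q i" by auto
    have c: "C \<subseteq> Domain R" "card C div 2 = i" using v(3) by (auto simp: lab_def split: if_splits)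
    have "inj_on fst (?E C)" using sv by (auto simp: inj_on_def single_valued_def)
    hence "card (?E C) = card (fst ` ?E C)" by (rule card_image[symmetric])
    also have "fst ` ?E C = {u \<in> C. isl u}" using c(1) by force
    also have "card \<dots> = i" using card_cycle[OF v(1)] card_split_isl[OF v(1)] c v(2) by simp
    finally show ?thesis .
  qed
  moreover have "card (\<Union>C\<in>?K. ?E C) = (\<Sum>C\<in>?K. card (?E C))"
  proof (rule card_UN_disjoint)
    show "\<forall>C\<in>?K. \<forall>D\<in>?K. C \<noteq> D \<longrightarrow> ?E C \<inter> ?E D = {}"
      using cls_image_disjoint[of _ R V] by (metis (no_types, lifting) disjoint_iff mem_Collect_eq)
  qed (use finite_comps finite_R in auto)
  ultimately show ?thesis by (simp add: S count_mon)
qed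

text \<open>For \<open>R = arcs s s'\<close>, \<open>ends\<close> and \<open>starts\<close> are the
  singletons of \<open>s\<close> in N+ and in N-, so their product consists of the pairs that can be
  added to \<open>s\<close>.\<close>

definition "ends = {x \<in> V. isl x \<and> x \<notin> Domain R}"
definition "starts = {y \<in> V. \<not> isl y \<and> y \<notin> Range R}"

lemma bij_ends:
  "bij_betw (cls R) {x \<in> ends. card (cls R x) = j} {C \<in> cls R ` V. lab R C = P True j}"
proof (rule bij_betwI')
  fix x x' assume "x \<in> {x \<in> ends. card (cls R x) = j}" "x' \<in> {x \<in> ends. card (cls R x) = j}"
  thus "cls R x = cls R x' \<longleftrightarrow> x = x'"
    using end_unique[of x x x'] by (auto simp: ends_def)
next
  fix x assume "x \<in> {x \<in> ends. card (cls R x) = j}"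
  thus "cls R x \<in> {C \<in> cls R ` V. lab R C = P True j}"
    using lab_path[of x x] by (auto simp: ends_def)
next
  fix C assume "C \<in> {C \<in> cls R ` V. lab R C = P True j}"
  then obtain v where v: "v \<in> V" "C = cls R v" "lab R (cls R v) = P True j" by auto
  obtain x where x: "x \<in> cls R v" "x \<notin> Domain R" "isl x" "card (cls R v) = j"
    using lab_end_conv[OF v(1,3)] by blast
  moreover have "cls R x = C" using x(1) v(2) cls_eq by metis
  ultimately show "\<exists>x\<in>{x \<in> ends. card (cls R x) = j}. C = cls R x"
    using cls_sub[OF v(1)] v(2) by (auto simp: ends_def)
qed

lemma bij_starts:
  "bij_betw (cls R) {y \<in> starts. card (cls R y) = i} {C \<in> cls R ` V. lab R C = P (bar i) i}"
proof (rule bij_betwI')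
  fix x x' assume "x \<in> {x \<in> starts. card (cls R x) = i}" "x' \<in> {x \<in> starts. card (cls R x) = i}"
  thus "cls R x = cls R x' \<longleftrightarrow> x = x'"
    using start_unique[of x x x'] by (auto simp: starts_def)
next
  fix x assume "x \<in> {x \<in> starts. card (cls R x) = i}"
  thus "cls R x \<in> {C \<in> cls R ` V. lab R C = P (bar i) i}"
    using lab_start[of x x] by (auto simp: starts_def)
next
  fix C assume "C \<in> {C \<in> cls R ` V. lab R C = P (bar i) i}"
  then obtain v where v: "v \<in> V" "C = cls R v" "lab R (cls R v) = P (bar i) i" by auto
  obtain x where x: "x \<in> cls R v" "x \<notin> Range R" "\<not> isl x" "card (cls R v) = i"
    using lab_start_conv[OF v(1,3)] by blast
  moreover have "cls R x = C" using x(1) v(2) cls_eq by metis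
  ultimately show "\<exists>x\<in>{x \<in> starts. card (cls R x) = i}. C = cls R x"
    using cls_sub[OF v(1)] v(2) by (auto simp: starts_def)
qed

text \<open>The relation \<open>S\<close> is left open in order to treat linking two paths
  (\<open>S\<close> is inequality) and closing one path (\<open>S\<close> is equality) at
  once.\<close>

lemma card_pairs:
  "card {p \<in> ends \<times> starts. card (cls R (snd p)) = i \<and> card (cls R (fst p)) = j \<and>
           S (cls R (fst p)) (cls R (snd p))}
   = card {p \<in> {C \<in> cls R ` V. lab R C = P True j} \<times> {C \<in> cls R ` V. lab R C = P (bar i) i}.
            S (fst p) (snd p)}" (is "card ?A = card ?B")
proof -
  let ?X = "{x \<in> ends. card (cls R x) = j}" and ?Y = "{y \<in> starts. card (cls R y) = i}"
  have bij: "bij_betw (map_prod (cls R) (cls R)) (?X \<times> ?Y)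
      ({C \<in> cls R ` V. lab R C = P True j} \<times> {C \<in> cls R ` V. lab R C = P (bar i) i})"
    using bij_ends bij_starts by (rule bij_betw_map_prod)
  have "bij_betw (map_prod (cls R) (cls R)) ?A ?B"
    unfolding bij_betw_def
  proof
    show "inj_on (map_prod (cls R) (cls R)) ?A"
      by (rule inj_on_subset[OF bij_betw_imp_inj_on[OF bij]]) auto
    show "map_prod (cls R) (cls R) ` ?A = ?B"
      unfolding bij_betw_imp_surj_on[OF bij, symmetric] by auto
  qed
  thus ?thesis by (rule bij_betw_same_card)
qed

lemma card_join_distinct:
  "card {p \<in> ends \<times> starts. card (cls R (snd p)) = i \<and> card (cls R (fst p)) = j \<and>
           cls R (fst p) \<noteq> cls R (snd p)}
   = count (mon V R) (P (bar i) i) * count (mon V R - {#P (bar i) i#}) (P True j)"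
  using card_pairs[of i j "(\<noteq>)"] by (simp add: card_distinct_pairs[OF finite_comps] mon_def)

text \<open>A + path with \<open>2i\<close> elements starts in N-, so exactly one pair closes it:
  its own end with its own start.\<close>

lemma card_join_same:
  "card {p \<in> ends \<times> starts. card (cls R (snd p)) = 2 * i \<and> card (cls R (fst p)) = 2 * i \<and>
           cls R (fst p) = cls R (snd p)} = count (mon V R) (P True (2 * i))"
proof -
  let ?U = "{C \<in> cls R ` V. lab R C = P True (2 * i)}"
  have "p \<in> (\<lambda>C. (C, C)) ` ?U \<longleftrightarrow> p \<in> ?U \<times> ?U \<and> fst p = snd p" for p
    by (cases p) (auto simp: image_iff)
  hence "{p \<in> ?U \<times> ?U. fst p = snd p} = (\<lambda>C. (C, C)) ` ?U" by blast
  moreover have "card ((\<lambda>C. (C, C)) ` ?U) = card ?U" by (rule card_image) (simp add: inj_on_def)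
  moreover have "bar (2 * i)" by (simp add: bar_def)
  ultimately show ?thesis using card_pairs[of "2 * i" "2 * i" "(=)"] by (simp add: count_mon)
qed

end

text \<open>As \<open>c\<close> differs from \<open>a\<close> and \<open>b\<close>, the equation
  itself forces \<open>a\<close> and \<open>b\<close> to be available in \<open>M\<close>, and the
  truncated subtractions are exact.\<close>

lemma mset_swap2:
  assumes "M' + {#a, b#} = M + {#c#}" "c \<noteq> a" "c \<noteq> b"
  shows "M' = M - {#a#} - {#b#} + {#c#}"
proof (rule multiset_eqI)
  fix u
  have "count (M' + {#a, b#}) u = count (M + {#c#}) u" using assms(1) by simp
  thus "count M' u = count (M - {#a#} - {#b#} + {#c#}) u"
    using assms(2,3) by (auto split: if_splits)
qed

lemma mset_swap1:
  assumes "M' + {#a#} = M + {#c#}" "c \<noteq> a"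
  shows "M' = M - {#a#} + {#c#}"
proof (rule multiset_eqI)
  fix u
  have "count (M' + {#a#}) u = count (M + {#c#}) u" using assms(1) by simp
  thus "count M' u = count (M - {#a#} + {#c#}) u"
    using assms(2) by (auto split: if_splits)
qed

section \<open>Sums over all moves and the four terms of W+\<close>

context alternating_graph
begin

lemma join_pair:
  assumes "p \<in> ends \<times> starts"
  defines "i \<equiv> card (cls R (snd p))" and "j \<equiv> card (cls R (fst p))"
  shows "1 \<le> i" "1 \<le> j" "i \<le> wt (mon V R)" "j \<le> wt (mon V R)"
    "cls R (fst p) \<noteq> cls R (snd p) \<Longrightarrow>
       mon V (insert p R) = mon V R - {#P (bar i) i#} - {#P True j#} + {#P (bar i) (i + j)#}"
    "cls R (fst p) = cls R (snd p) \<Longrightarrow> even i \<and>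
       mon V (insert p R) = mon V R - {#P True (2 * (i div 2))#} + {#Q (i div 2)#}"
proof -
  interpret J: join V R "fst p" "snd p"
    using assms(1) by unfold_locales (auto simp: ends_def starts_def)
  show i: "1 \<le> i" and j: "1 \<le> j" using card_cls_pos J.xV J.yV by (simp_all add: i_def j_def)
  show "i \<le> wt (mon V R)" using vidx_le_wt[OF lab_in_mon[OF J.yV]] J.lab_y by (simp add: i_def)
  show "j \<le> wt (mon V R)" using vidx_le_wt[OF lab_in_mon[OF J.xV]] J.lab_x by (simp add: j_def)
  show "mon V (insert p R) = mon V R - {#P (bar i) i#} - {#P True j#} + {#P (bar i) (i + j)#}"
    if "cls R (fst p) \<noteq> cls R (snd p)"
    \<comment> \<open>Positivity of \<open>i\<close> and \<open>j\<close> makes the variable of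
      index \<open>i + j\<close> differ from both variables it replaces, as
      \<open>mset_swap2\<close> requires.\<close>
    using J.join_distinct(3)[OF that] i j
    by (intro mset_swap2) (simp_all add: i_def j_def)
  show "even i \<and> mon V (insert p R) = mon V R - {#P True (2 * (i div 2))#} + {#Q (i div 2)#}"
    if eq: "cls R (fst p) = cls R (snd p)"
  proof
    show "even i" using J.join_same(2)[OF eq] eq by (metis dvd_triv_left i_def)
    show "mon V (insert p R) = mon V R - {#P True (2 * (i div 2))#} + {#Q (i div 2)#}"
      using J.join_same(4)[OF eq] by (intro mset_swap1) (simp_all add: i_def eq)
  qed
qed

text \<open>The first-order terms of W+ with an index split or a cycle opened: arcs are grouped by
  the sizes of the pieces, according to whether their removal disconnects the component.\<close>

lemma sum_cuts:
  "(\<Sum>e\<in>{e \<in> R. isl (fst e)}. ind (mon V (R - {e}) = m')) =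
     (\<Sum>i\<in>{1..wt (mon V R)}. \<Sum>j\<in>{1..wt (mon V R)}.
        of_nat (count (mon V R) (P (bar i) (i + j)))
          * ind (m' = mon V R - {#P (bar i) (i + j)#} + {#P (bar i) i, P True j#}))
   + (\<Sum>i\<in>{1..wt (mon V R)}.
        of_nat i * of_nat (count (mon V R) (Q i))
          * ind (m' = mon V R - {#Q i#} + {#P True (2 * i)#}))"
proof -
  let ?m = "mon V R" and ?w = "{1..wt (mon V R)}"
  let ?S1 = "{e \<in> R. isl (fst e) \<and> cls (R - {e}) (fst e) \<noteq> cls (R - {e}) (snd e)}"
  let ?S2 = "{e \<in> R. isl (fst e) \<and> cls (R - {e}) (fst e) = cls (R - {e}) (snd e)}"
  let ?g = "\<lambda>e. (card (cls (R - {e}) (snd e)), card (cls (R - {e}) (fst e)))"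
  let ?h = "\<lambda>e. card (cls (R - {e}) (fst e)) div 2"
  let ?F = "\<lambda>(i, j). ind (m' = ?m - {#P (bar i) (i + j)#} + {#P (bar i) i, P True j#})"
  let ?G = "\<lambda>i. ind (m' = ?m - {#Q i#} + {#P True (2 * i)#})"
  have fin: "finite ?S1" "finite ?S2" using finite_R by auto
  have V: "fst e \<in> V" if "e \<in> R" for e using that R_sub by auto
  have "(\<Sum>e\<in>{e \<in> R. isl (fst e)}. ind (mon V (R - {e}) = m'))
      = (\<Sum>e\<in>?S1 \<union> ?S2. ind (mon V (R - {e}) = m'))" by (rule sum.cong) auto
  also have "\<dots> = (\<Sum>e\<in>?S1. ind (mon V (R - {e}) = m')) + (\<Sum>e\<in>?S2. ind (mon V (R - {e}) = m'))"
    using fin by (intro sum.union_disjoint) auto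
  also have "(\<Sum>e\<in>?S1. ind (mon V (R - {e}) = m')) = (\<Sum>e\<in>?S1. ?F (?g e))"
    by (intro sum.cong refl) (auto simp: cut_distinct(4) eq_commute)
  also have "\<dots> = (\<Sum>t\<in>?w \<times> ?w. of_nat (card {e \<in> ?S1. ?g e = t}) * ?F t)"
  proof (rule sum_fiber[OF fin(1)])
    show "?g ` ?S1 \<subseteq> ?w \<times> ?w"
    proof (rule image_subsetI)
      fix e assume "e \<in> ?S1"
      hence e: "e \<in> R" "isl (fst e)" "cls (R - {e}) (fst e) \<noteq> cls (R - {e}) (snd e)" by simp_all
      note c = cut_distinct[OF e]
      \<comment> \<open>Here \<open>i + j\<close> is the index of a variable occurring in the
        monomial, hence at most its weight; so the truncated range of \<open>Wcoef\<close> misses no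
        move.\<close>
      show "?g e \<in> ?w \<times> ?w"
        using vidx_le_wt[OF lab_in_mon[OF V[OF e(1)]]] c(1,2) unfolding c(3) by simp
    qed
  qed simp
  also have "\<dots> = (\<Sum>(i, j)\<in>?w \<times> ?w. of_nat (count ?m (P (bar i) (i + j))) * ?F (i, j))"
    by (intro sum.cong refl) (auto simp flip: card_cut_distinct intro!: arg_cong[of _ _ card])
  also have "\<dots> = (\<Sum>i\<in>?w. \<Sum>j\<in>?w. of_nat (count ?m (P (bar i) (i + j))) * ?F (i, j))"
    by (rule sum.cartesian_product[symmetric])
  also have "(\<Sum>e\<in>?S2. ind (mon V (R - {e}) = m')) = (\<Sum>e\<in>?S2. ?G (?h e))"
    by (intro sum.cong refl) (auto simp: cut_same(3) eq_commute)
  also have "\<dots> = (\<Sum>t\<in>?w. of_nat (card {e \<in> ?S2. ?h e = t}) * ?G t)"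
  proof (rule sum_fiber[OF fin(2)])
    show "?h ` ?S2 \<subseteq> ?w"
    proof (rule image_subsetI)
      fix e assume "e \<in> ?S2"
      hence e: "e \<in> R" "isl (fst e)" "cls (R - {e}) (fst e) = cls (R - {e}) (snd e)" by simp_all
      note c = cut_same[OF e]
      show "?h e \<in> ?w"
        using vidx_le_wt[OF lab_in_mon[OF V[OF e(1)]]] c(1) unfolding c(2) by simp
    qed
  qed simp
  also have "\<dots> = (\<Sum>i\<in>?w. of_nat i * of_nat (count ?m (Q i)) * ?G i)"
    by (intro sum.cong refl)
      (auto simp: conj_assoc simp flip: card_cut_same of_nat_mult)
  finally show ?thesis by simp
qed

text \<open>The second-order term and \<open>q_i d/dp_{2i}^+\<close>: pairs are grouped by the sizes
  of the paths they touch, according to whether these are distinct.\<close>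

lemma sum_joins:
  "(\<Sum>p\<in>ends \<times> starts. ind (mon V (insert p R) = m')) =
     (\<Sum>i\<in>{1..wt (mon V R)}. \<Sum>j\<in>{1..wt (mon V R)}.
        of_nat (count (mon V R) (P (bar i) i) * count (mon V R - {#P (bar i) i#}) (P True j))
          * ind (m' = mon V R - {#P (bar i) i#} - {#P True j#} + {#P (bar i) (i + j)#}))
   + (\<Sum>i\<in>{1..wt (mon V R)}.
        of_nat (count (mon V R) (P True (2 * i)))
          * ind (m' = mon V R - {#P True (2 * i)#} + {#Q i#}))"
proof -
  let ?m = "mon V R" and ?w = "{1..wt (mon V R)}"
  let ?S1 = "{p \<in> ends \<times> starts. cls R (fst p) \<noteq> cls R (snd p)}"
  let ?S2 = "{p \<in> ends \<times> starts. cls R (fst p) = cls R (snd p)}"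
  let ?g = "\<lambda>p. (card (cls R (snd p)), card (cls R (fst p)))"
  let ?h = "\<lambda>p. card (cls R (snd p)) div 2"
  let ?F = "\<lambda>(i, j). ind (m' = ?m - {#P (bar i) i#} - {#P True j#} + {#P (bar i) (i + j)#})"
  let ?G = "\<lambda>i. ind (m' = ?m - {#P True (2 * i)#} + {#Q i#})"
  have "finite (ends \<times> starts)" using finite_V by (simp add: ends_def starts_def)
  hence fin: "finite ?S1" "finite ?S2" by auto
  have "(\<Sum>p\<in>ends \<times> starts. ind (mon V (insert p R) = m'))
      = (\<Sum>p\<in>?S1 \<union> ?S2. ind (mon V (insert p R) = m'))" by (rule sum.cong) auto
  also have "\<dots> = (\<Sum>p\<in>?S1. ind (mon V (insert p R) = m')) + (\<Sum>p\<in>?S2. ind (mon V (insert p R) = m'))"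
    using fin by (intro sum.union_disjoint) auto
  also have "(\<Sum>p\<in>?S1. ind (mon V (insert p R) = m')) = (\<Sum>p\<in>?S1. ?F (?g p))"
  proof (intro sum.cong refl)
    fix p assume "p \<in> ?S1"
    thus "ind (mon V (insert p R) = m') = ?F (?g p)"
      using join_pair(5)[of p] by (simp add: eq_commute)
  qed
  also have "\<dots> = (\<Sum>t\<in>?w \<times> ?w. of_nat (card {p \<in> ?S1. ?g p = t}) * ?F t)"
    by (rule sum_fiber[OF fin(1)]) (use join_pair(1-4) in \<open>fastforce+\<close>)
  also have "\<dots> = (\<Sum>(i, j)\<in>?w \<times> ?w.
      of_nat (count ?m (P (bar i) i) * count (?m - {#P (bar i) i#}) (P True j)) * ?F (i, j))"
  proof (intro sum.cong refl)
    fix t :: "nat \<times> nat"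
    obtain i j where t: "t = (i, j)" by (cases t)
    have "{p \<in> ?S1. ?g p = (i, j)} = {p \<in> ends \<times> starts. card (cls R (snd p)) = i \<and>
        card (cls R (fst p)) = j \<and> cls R (fst p) \<noteq> cls R (snd p)}" by blast
    thus "of_nat (card {p \<in> ?S1. ?g p = t}) * ?F t = (case t of (i, j) \<Rightarrow>
      of_nat (count ?m (P (bar i) i) * count (?m - {#P (bar i) i#}) (P True j)) * ?F (i, j))"
      unfolding t prod.case by (simp only: card_join_distinct)
  qed
  also have "\<dots> = (\<Sum>i\<in>?w. \<Sum>j\<in>?w.
      of_nat (count ?m (P (bar i) i) * count (?m - {#P (bar i) i#}) (P True j)) * ?F (i, j))"
    by (rule sum.cartesian_product[symmetric])
  also have "(\<Sum>p\<in>?S2. ind (mon V (insert p R) = m')) = (\<Sum>p\<in>?S2. ?G (?h p))"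
  proof (intro sum.cong refl)
    fix p assume "p \<in> ?S2"
    thus "ind (mon V (insert p R) = m') = ?G (?h p)"
      using join_pair(6)[of p] by (simp add: eq_commute)
  qed
  also have "\<dots> = (\<Sum>t\<in>?w. of_nat (card {p \<in> ?S2. ?h p = t}) * ?G t)"
  proof (rule sum_fiber[OF fin(2)])
    show "?h ` ?S2 \<subseteq> ?w"
    proof (rule image_subsetI)
      fix p assume "p \<in> ?S2"
      hence p: "p \<in> ends \<times> starts" "cls R (fst p) = cls R (snd p)" by simp_all
      from join_pair(1,3)[OF p(1)] conjunct1[OF join_pair(6)[OF p]]
      show "?h p \<in> ?w" by (auto elim: evenE)
    qed
  qed simp
  also have "\<dots> = (\<Sum>i\<in>?w. of_nat (count ?m (P True (2 * i))) * ?G i)"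
  proof (intro sum.cong refl)
    fix i
    have "{p \<in> ?S2. ?h p = i} = {p \<in> ends \<times> starts. card (cls R (snd p)) = 2 * i \<and>
        card (cls R (fst p)) = 2 * i \<and> cls R (fst p) = cls R (snd p)}"
      using join_pair(6) by force
    thus "of_nat (card {p \<in> ?S2. ?h p = i}) * ?G i = of_nat (count ?m (P True (2 * i))) * ?G i"
      by (simp only: card_join_same)
  qed
  finally show ?thesis by simp
qed

lemma sum_moves:
  "(\<Sum>e\<in>{e \<in> R. isl (fst e)}. ind (mon V (R - {e}) = m')) +
     (\<Sum>p\<in>ends \<times> starts. ind (mon V (insert p R) = m')) = Wcoef (mon V R) m'"
  unfolding sum_cuts sum_joins Wcoef_def by (simp add: sum.distrib)

end

section \<open>States and types\<close>

definition arc :: "nat \<times> nat \<Rightarrow> vtx \<times> vtx" where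
  "arc p = (Inl (fst p), Inr (snd p))"

text \<open>A pair lying in both states yields two opposite arcs, a directed 2-cycle. The
  orientation thus records the multigraph without multiple edges.\<close>

definition arcs :: "state \<Rightarrow> state \<Rightarrow> vtx rel" where
  "arcs s s' = arc ` s \<union> (arc ` s')\<inverse>"

lemma mem_arcs [simp]:
  "(Inl a, Inr b) \<in> arcs s s' \<longleftrightarrow> (a, b) \<in> s"
  "(Inr b, Inl a) \<in> arcs s s' \<longleftrightarrow> (a, b) \<in> s'"
  "(Inl a, Inl a') \<notin> arcs s s'" "(Inr b, Inr b') \<notin> arcs s s'"
  by (force simp: arcs_def arc_def)+

lemma arcsE:
  assumes "(v, w) \<in> arcs s s'"
  obtains a b where "v = Inl a" "w = Inr b" "(a, b) \<in> s"
    | a b where "v = Inr b" "w = Inl a" "(a, b) \<in> s'"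
  using assms by (cases v; cases w) auto

lemma inj_arc: "inj arc"
  by (auto simp: inj_def arc_def prod_eq_iff)

lemma arcs_insert: "arcs (insert p s) s' = insert (arc p) (arcs s s')"
  by (auto simp: arcs_def)

lemma arcs_remove: "arcs (s - {p}) s' = arcs s s' - {arc p}"
proof -
  have "arc p \<notin> (arc ` s')\<inverse>" by (auto simp: arc_def)
  moreover have "arc ` (s - {p}) = arc ` s - {arc p}"
    using image_set_diff[OF inj_arc, of s "{p}"] by simp
  ultimately show ?thesis unfolding arcs_def by blast
qed

lemma comp_eq_cls: "comp s s' = cls (arcs s s')"
proof -
  have "edges s s' \<union> (edges s s')\<inverse> = arcs s s' \<union> (arcs s s')\<inverse>"
    by (auto simp: edges_def elim!: arcsE)
  thus ?thesis by (auto simp: comp_def cls_def)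
qed

lemma matched_arcs:
  "matched s v \<longleftrightarrow> (if isl v then v \<in> Domain (arcs s s') else v \<in> Range (arcs s s'))"
  "matched s' v \<longleftrightarrow> (if isl v then v \<in> Range (arcs s s') else v \<in> Domain (arcs s s'))"
  by (cases v; auto simp: matched_def Domain_iff Range_iff elim!: arcsE intro: mem_arcs(1,2)[THEN iffD2])+

lemma deg_arcs:
  "deg s s' v = of_bool (v \<in> Domain (arcs s s')) + of_bool (v \<in> Range (arcs s s'))"
  by (simp add: deg_def matched_arcs(1)[of s v s'] matched_arcs(2)[of s' v s])

lemma finite_vertices: "finite (vertices np nm)"
  by (simp add: vertices_def)

lemma mem_vertices [simp]:
  "Inl a \<in> vertices np nm \<longleftrightarrow> a < np" "Inr b \<in> vertices np nm \<longleftrightarrow> b < nm"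
  by (auto simp: vertices_def)

lemma alternating_arcs:
  assumes "s \<in> states np nm" "s' \<in> states np nm"
  shows "alternating_graph (vertices np nm) (arcs s s')"
proof
  show "arcs s s' \<subseteq> vertices np nm \<times> vertices np nm"
    using assms by (auto simp: states_def is_state_def elim!: arcsE)
  show "single_valued (arcs s s')" "single_valued ((arcs s s')\<inverse>)"
    using assms unfolding states_def is_state_def
    by (auto intro!: single_valuedI elim!: arcsE)
qed (auto simp: finite_vertices elim!: arcsE)

lemma filter_mset_split:
  assumes "\<And>x. x \<in># M \<Longrightarrow> A x \<longleftrightarrow> \<not> C x \<and> p x" "\<And>x. x \<in># M \<Longrightarrow> B x \<longleftrightarrow> \<not> C x \<and> \<not> p x"
  shows "M = filter_mset A M + filter_mset B M + filter_mset C M"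
  using assms by (induction M) auto

context alternating_graph
begin

text \<open>Degree 2 means an outgoing and an incoming arc; on a whole component either condition
  implies the other.\<close>

lemma is_cycle_iff:
  assumes R: "R = arcs s s'" and v: "v \<in> V"
  shows "is_cycle s s' (cls R v) \<longleftrightarrow> cls R v \<subseteq> Domain R"
proof -
  have "is_cycle s s' (cls R v) \<longleftrightarrow> cls R v \<subseteq> Domain R \<and> cls R v \<subseteq> Range R"
    unfolding is_cycle_def deg_arcs R[symmetric] by (auto simp: of_bool_def subset_iff split: if_splits)
  thus ?thesis using Domain_iff_Range[OF v] by blast
qed

text \<open>With an odd number of elements both endpoints lie on the side of the last one,
  \<open>z\<close>. With an even number they lie on opposite sides, and the state in which both are
  singletons is \<open>s\<close> if \<open>z\<close> is in N+ and \<open>s'\<close> if it is in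
  N-.\<close>

lemma path_sign_iff:
  assumes R: "R = arcs s s'" and v: "v \<in> V" and z: "z \<in> cls R v" "z \<notin> Domain R"
  shows "plus_path s s' (cls R v) \<longleftrightarrow> isl z" "minus_path s s' (cls R v) \<longleftrightarrow> \<not> isl z"
proof -
  have nc: "\<not> cls R v \<subseteq> Domain R" using z by auto
  then obtain y where y: "y \<in> cls R v" "y \<notin> Range R" using Domain_iff_Range[OF v] by auto
  have "cls R v - Domain R = {z}" "cls R v - Range R = {y}"
    using end_unique start_unique y z by blast+
  hence ends: "endpoints s s' (cls R v) = {z, y}"
    unfolding endpoints_def deg_arcs R[symmetric] by (auto simp: of_bool_def split: if_splits)
  have dom: "y \<in> Domain R" "z \<in> Range R" if "y \<noteq> z"
    using \<open>cls R v - Domain R = {z}\<close> \<open>cls R v - Range R = {y}\<close> y z that by auto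
  have m: "matched s u \<longleftrightarrow> (if isl u then u \<in> Domain R else u \<in> Range R)"
    "matched s' u \<longleftrightarrow> (if isl u then u \<in> Range R else u \<in> Domain R)" for u
    unfolding R by (rule matched_arcs)+
  note par = even_card_path[OF v z y]
  show "plus_path s s' (cls R v) \<longleftrightarrow> isl z" "minus_path s s' (cls R v) \<longleftrightarrow> \<not> isl z"
    unfolding plus_path_def minus_path_def is_cycle_iff[OF R v] ends m par
    using nc dom y z by (cases "isl y"; cases "isl z"; fastforce)+
qed

lemma pmon_type_of:
  assumes R: "R = arcs s s'" and V: "V = vertices np nm"
  shows "pmon (type_of np nm (s, s')) = mon V R"
proof -
  let ?M = "mset_set (cls R ` V)"
  have sign: "is_cycle s s' C \<longleftrightarrow> C \<subseteq> Domain R"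
    "plus_path s s' C \<longleftrightarrow> \<not> is_cycle s s' C \<and> (\<forall>z\<in>C - Domain R. isl z)"
    "minus_path s s' C \<longleftrightarrow> \<not> is_cycle s s' C \<and> \<not> (\<forall>z\<in>C - Domain R. isl z)" if C: "C \<in># ?M" for C
  proof -
    obtain v where v: "v \<in> V" "C = cls R v" using C finite_comps by auto
    show c: "is_cycle s s' C \<longleftrightarrow> C \<subseteq> Domain R" using is_cycle_iff[OF R v(1)] v(2) by simp
    show "plus_path s s' C \<longleftrightarrow> \<not> is_cycle s s' C \<and> (\<forall>z\<in>C - Domain R. isl z)"
      "minus_path s s' C \<longleftrightarrow> \<not> is_cycle s s' C \<and> \<not> (\<forall>z\<in>C - Domain R. isl z)"
    proof -
      consider "C \<subseteq> Domain R" | z where "z \<in> C" "z \<notin> Domain R" by auto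
      hence "(plus_path s s' C \<longleftrightarrow> \<not> is_cycle s s' C \<and> (\<forall>z\<in>C - Domain R. isl z)) \<and>
        (minus_path s s' C \<longleftrightarrow> \<not> is_cycle s s' C \<and> \<not> (\<forall>z\<in>C - Domain R. isl z))"
      proof cases
        case 1
        thus ?thesis using c by (simp add: plus_path_def minus_path_def)
      next
        case (2 z)
        have "C - Domain R = {z}" using cls_end[OF v(1)] 2 v(2) by simp
        thus ?thesis using path_sign_iff[OF R v(1), of z] 2 v(2) c by auto
      qed
      thus "plus_path s s' C \<longleftrightarrow> \<not> is_cycle s s' C \<and> (\<forall>z\<in>C - Domain R. isl z)"
        "minus_path s s' C \<longleftrightarrow> \<not> is_cycle s s' C \<and> \<not> (\<forall>z\<in>C - Domain R. isl z)" by blast+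
    qed
  qed
  have "mon V R = image_mset (lab R) (filter_mset (plus_path s s') ?M
      + filter_mset (minus_path s s') ?M + filter_mset (is_cycle s s') ?M)"
    using filter_mset_split[OF sign(2,3)] unfolding mon_def by (rule arg_cong)
  also have "\<dots> = image_mset (\<lambda>C. P True (card C)) (filter_mset (plus_path s s') ?M)
      + image_mset (\<lambda>C. P False (card C)) (filter_mset (minus_path s s') ?M)
      + image_mset (\<lambda>C. Q (card C div 2)) (filter_mset (is_cycle s s') ?M)"
    unfolding image_mset_union
    by (intro arg_cong2[of _ _ _ _ "(+)"] image_mset_cong) (use sign in \<open>auto simp: lab_def\<close>)
  finally show ?thesis
    by (simp add: type_of_def pmon_def comps_def comp_eq_cls R V Let_def multiset.map_comp comp_def
        Fun.comp_def)
qed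

end

text \<open>The bidegree of a variable: \<open>half True\<close> is its first coordinate,
  \<open>half False\<close> its second.\<close>

fun half :: "bool \<Rightarrow> var \<Rightarrow> nat" where
  "half b (P c k) = (if b = c then (k + 1) div 2 else k div 2)"
| "half b (Q k) = k"

definition Mons :: "nat \<Rightarrow> nat \<Rightarrow> var multiset set" where
  "Mons np nm = {m. (\<forall>v\<in>#m. 1 \<le> vidx v) \<and>
     sum_mset (image_mset (half True) m) = np \<and> sum_mset (image_mset (half False) m) = nm}"

lemma Types_iff: "\<mu> \<in> Types np nm \<longleftrightarrow> pmon \<mu> \<in> Mons np nm"
  by (cases \<mu>)
    (auto simp: Types_def Mons_def pmon_def nplus_def nminus_def multiset.map_comp Fun.comp_def ball_Un)

lemma surj_pmon: "\<exists>\<mu>. pmon \<mu> = m"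
proof (induction m)
  case empty
  show ?case by (rule exI[of _ "({#}, {#}, {#})"]) (simp add: pmon_def)
next
  case (add v m)
  then obtain kp km l where m: "pmon (kp, km, l) = m" by (metis surj_pair)
  show ?case
  proof (cases v)
    case (P c k)
    show ?thesis
      by (rule exI[of _ "if c then (add_mset k kp, km, l) else (kp, add_mset k km, l)"])
        (use m P in \<open>auto simp: pmon_def\<close>)
  next
    case (Q k)
    show ?thesis
      by (rule exI[of _ "(kp, km, add_mset k l)"]) (use m Q in \<open>auto simp: pmon_def\<close>)
  qed
qed

lemma pmon_image_Types: "pmon ` Types np nm = Mons np nm"
proof (intro equalityI subsetI)
  fix m assume m: "m \<in> Mons np nm"
  obtain \<mu> where "pmon \<mu> = m" using surj_pmon by blast
  with m show "m \<in> pmon ` Types np nm" using Types_iff by blast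
qed (auto simp: Types_iff)

lemma count_image_mset_inj_eq: "inj f \<Longrightarrow> count (image_mset f M) (f x) = count M x"
  by (induction M) (auto dest: injD)

lemma count_pmon:
  "count (pmon (kp, km, l)) (P True k) = count kp k"
  "count (pmon (kp, km, l)) (P False k) = count km k"
  "count (pmon (kp, km, l)) (Q k) = count l k"
proof -
  have inj: "inj (P c)" "inj Q" for c by (auto simp: inj_def)
  have "P True k \<notin># image_mset (P False) km" "P True k \<notin># image_mset Q l"
    "P False k \<notin># image_mset (P True) kp" "P False k \<notin># image_mset Q l"
    "Q k \<notin># image_mset (P True) kp" "Q k \<notin># image_mset (P False) km" by auto
  note 0 = this[unfolded not_in_iff]
  show "count (pmon (kp, km, l)) (P True k) = count kp k"
    "count (pmon (kp, km, l)) (P False k) = count km k"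
    "count (pmon (kp, km, l)) (Q k) = count l k"
    by (simp_all add: pmon_def 0 count_image_mset_inj_eq inj)
qed

lemma inj_pmon: "inj pmon"
proof (rule injI)
  fix \<mu> \<nu> :: ttype assume eq: "pmon \<mu> = pmon \<nu>"
  obtain kp km l kp' km' l' where *: "\<mu> = (kp, km, l)" "\<nu> = (kp', km', l')"
    by (metis surj_pair)
  have "kp = kp'" "km = km'" "l = l'"
    using count_pmon[of kp km l] count_pmon[of kp' km' l'] eq * by (auto intro!: multiset_eqI)
  thus "\<mu> = \<nu>" by (simp add: *)
qed

text \<open>Each index is at least 1 and at most the total degree of its variable, so
  \<open>np + nm\<close> bounds both the number of variables and their indices.\<close>

lemma finite_Mons: "finite (Mons np nm)"
proof -
  let ?N = "np + nm"
  let ?A = "(\<lambda>(c, k). P c k) ` (UNIV \<times> {..?N}) \<union> Q ` {..?N}"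
  have "m \<in> mset ` {xs. set xs \<subseteq> ?A \<and> length xs \<le> ?N}" if m: "m \<in> Mons np nm" for m
  proof -
    have N: "sum_mset (image_mset (\<lambda>v. half True v + half False v) m) = ?N"
      using m by (simp add: Mons_def sum_mset.distrib)
    have half: "vidx v \<le> half True v + half False v" for v
      by (cases v) auto
    have "1 \<le> half True v + half False v" if "v \<in># m" for v
      using half[of v] m that by (force simp: Mons_def)
    hence "sum_mset (image_mset (\<lambda>_. 1) m) \<le> ?N"
      unfolding N[symmetric] by (rule sum_mset_mono)
    hence "size m \<le> ?N" by simp
    moreover have "v \<in> ?A" if "v \<in># m" for v
    proof -
      have "vidx v \<le> ?N"
        using half[of v] that unfolding N[symmetric]
        by (metis (no_types, lifting) image_mset_add_mset le_add1 le_trans multi_member_split sum_mset.insert)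
      thus ?thesis by (cases v) auto
    qed
    moreover obtain xs where "m = mset xs" by (metis ex_mset)
    ultimately show ?thesis by auto
  qed
  moreover have "finite {xs. set xs \<subseteq> ?A \<and> length xs \<le> ?N}"
    by (rule finite_lists_length_le) auto
  ultimately show ?thesis by (meson finite_imageI finite_subset subsetI)
qed

lemma finite_Types: "finite (Types np nm)"
  using finite_Mons inj_on_subset[OF inj_pmon subset_UNIV]
  by (auto simp flip: pmon_image_Types dest: finite_imageD)

section \<open>Bidegree of the monomial of a transition\<close>

context alternating_graph
begin

text \<open>The bidegree of a label counts the elements of the component on each side, so the total
  over all components is \<open>np\<close> and \<open>nm\<close>.\<close>

lemma half_lab:
  assumes "v \<in> V"
  shows "half b (lab R (cls R v)) = card {u \<in> cls R v. isl u = b}"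
proof (cases "cls R v \<subseteq> Domain R")
  case True
  thus ?thesis
    using card_cycle[OF assms True] card_split_isl[OF assms] by (cases b) (auto simp: lab_def)
next
  case False
  obtain z y where zy: "z \<in> cls R v" "z \<notin> Domain R" "y \<in> cls R v" "y \<notin> Range R"
    using path_ends[OF assms False] .
  show ?thesis
    using card_path[OF assms zy] card_split_isl[OF assms]
    unfolding lab_path[OF assms zy(1,2)]
    by (cases "isl z"; cases "isl y"; cases b; simp; presburger)
qed

lemma vidx_lab:
  assumes "v \<in> V"
  shows "1 \<le> vidx (lab R (cls R v))"
proof -
  have "half True (lab R (cls R v)) + half False (lab R (cls R v)) \<ge> 1"
    using half_lab[OF assms] card_split_isl[OF assms] card_cls_pos[OF assms] by simp
  thus ?thesis by (cases "lab R (cls R v)") (auto split: if_splits)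
qed

lemma sum_half_mon: "sum_mset (image_mset (half b) (mon V R)) = card {u \<in> V. isl u = b}"
proof -
  have "sum_mset (image_mset (half b) (mon V R)) = (\<Sum>C\<in>cls R ` V. half b (lab R C))"
    by (simp add: mon_def multiset.map_comp Fun.comp_def sum_unfold_sum_mset)
  also have "\<dots> = (\<Sum>C\<in>cls R ` V. card {u \<in> C. isl u = b})"
    using half_lab by (intro sum.cong) auto
  also have "\<dots> = card (\<Union>C\<in>cls R ` V. {u \<in> C. isl u = b})"
  proof (rule card_UN_disjoint[symmetric])
    show "\<forall>C\<in>cls R ` V. \<forall>D\<in>cls R ` V. C \<noteq> D \<longrightarrow> {u \<in> C. isl u = b} \<inter> {u \<in> D. isl u = b} = {}"
      using cls_image_disjoint[of _ R V] by (metis (no_types, lifting) disjoint_iff mem_Collect_eq)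
  qed (use finite_comps finite_cls in auto)
  also have "(\<Union>C\<in>cls R ` V. {u \<in> C. isl u = b}) = {u \<in> V. isl u = b}"
    using cls_sub cls_refl by blast
  finally show ?thesis .
qed

lemma mon_in_Mons:
  assumes "V = vertices np nm"
  shows "mon V R \<in> Mons np nm"
proof -
  have "{u \<in> V. isl u = True} = Inl ` {..<np}" "{u \<in> V. isl u = False} = Inr ` {..<nm}"
    unfolding assms by (auto simp: vertices_def)
  hence "card {u \<in> V. isl u = True} = np" "card {u \<in> V. isl u = False} = nm"
    by (simp_all add: card_image)
  thus ?thesis
    using vidx_lab sum_half_mon finite_comps by (auto simp: Mons_def mon_def)
qed

end

text \<open>One elementary join, stated on monomials alone; no transition realizing them is
  assumed.\<close>

definition joins_to :: "var multiset \<Rightarrow> var multiset \<Rightarrow> bool" where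
  "joins_to m m' \<longleftrightarrow>
     (\<exists>r i j. 1 \<le> i \<and> 1 \<le> j \<and> m = r + {#P (bar i) i, P True j#} \<and> m' = r + {#P (bar i) (i + j)#}) \<or>
     (\<exists>r i. 1 \<le> i \<and> m = r + {#P True (2 * i)#} \<and> m' = r + {#Q i#})"

text \<open>Joins respect bidegree: that of \<open>p_{i+j}\<close> with sign \<open>bar i\<close> is
  the sum of those of \<open>p_i\<close> with sign \<open>bar i\<close> and of \<open>p_j^+\<close>,
  and \<open>q_i\<close> has that of \<open>p_{2i}^+\<close>.\<close>

lemma joins_to_Mons:
  assumes "joins_to m m'"
  shows "m \<in> Mons np nm \<longleftrightarrow> m' \<in> Mons np nm"
proof -
  have h: "half b (P (bar i) (i + j)) = half b (P (bar i) i) + half b (P True j)" for b i j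
    by (cases b) (simp_all add: bar_def, presburger+)
  have sum: "sum_mset (image_mset (half b) m) = sum_mset (image_mset (half b) m')" for b
    using assms unfolding joins_to_def
  proof (elim disjE exE conjE)
    fix r i j assume "m = r + {#P (bar i) i, P True j#}" "m' = r + {#P (bar i) (i + j)#}"
    thus ?thesis using h[of b i j] by (simp del: half.simps)
  qed simp
  have "(\<forall>v\<in>#m. 1 \<le> vidx v) \<longleftrightarrow> (\<forall>v\<in>#m'. 1 \<le> vidx v)"
    using assms unfolding joins_to_def by (elim disjE exE conjE) simp_all
  thus ?thesis unfolding Mons_def mem_Collect_eq sum by simp
qed

lemma sum_terms_eq_0_iff:
  fixes A B :: "nat \<Rightarrow> nat \<Rightarrow> rat" and C D :: "nat \<Rightarrow> rat"
  assumes "finite T" "\<And>i j. 0 \<le> A i j" "\<And>i j. 0 \<le> B i j" "\<And>i. 0 \<le> C i" "\<And>i. 0 \<le> D i"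
  shows "(\<Sum>i\<in>T. \<Sum>j\<in>T. A i j + B i j) + (\<Sum>i\<in>T. C i + D i) = 0 \<longleftrightarrow>
    (\<forall>i\<in>T. \<forall>j\<in>T. A i j = 0 \<and> B i j = 0) \<and> (\<forall>i\<in>T. C i = 0 \<and> D i = 0)"
  using assms by (simp add: add_nonneg_eq_0_iff sum_nonneg_eq_0_iff sum_nonneg)

text \<open>All terms are nonnegative, so nothing cancels and the sum vanishes only
  termwise.\<close>

lemma Wcoef_eq_0_iff:
  "Wcoef m m' = 0 \<longleftrightarrow>
     (\<forall>i\<in>{1..wt m}. \<forall>j\<in>{1..wt m}.
        (P (bar i) (i + j) \<in># m \<longrightarrow> m' \<noteq> m - {#P (bar i) (i + j)#} + {#P (bar i) i, P True j#}) \<and>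
        (P (bar i) i \<in># m \<longrightarrow> P True j \<in># m - {#P (bar i) i#} \<longrightarrow>
           m' \<noteq> m - {#P (bar i) i#} - {#P True j#} + {#P (bar i) (i + j)#})) \<and>
     (\<forall>i\<in>{1..wt m}.
        (Q i \<in># m \<longrightarrow> m' \<noteq> m - {#Q i#} + {#P True (2 * i)#}) \<and>
        (P True (2 * i) \<in># m \<longrightarrow> m' \<noteq> m - {#P True (2 * i)#} + {#Q i#}))"
proof -
  have t: "of_nat (count M a) * ind c = 0 \<longleftrightarrow> (a \<in># M \<longrightarrow> \<not> c)"
    "of_nat (count M a * count N b) * ind c = 0 \<longleftrightarrow> (a \<in># M \<longrightarrow> b \<in># N \<longrightarrow> \<not> c)"
    "of_nat i * of_nat (count M a) * ind c = 0 \<longleftrightarrow> i = 0 \<or> (a \<in># M \<longrightarrow> \<not> c)"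
    for M N :: "var multiset" and a b c i by (auto simp: ind_def count_eq_zero_iff)
  show ?thesis
    unfolding Wcoef_def
    by (subst sum_terms_eq_0_iff, simp, (simp add: ind_def; fail)+, unfold t,
        intro conj_cong ball_cong refl) auto
qed

section \<open>Support of W+ and double counting\<close>

text \<open>The terms of W+ come in mutually inverse pairs, a join and a cut, so the support is
  symmetric although the coefficients are not.\<close>

lemma Wcoef_nonzero_iff: "Wcoef m m' \<noteq> 0 \<longleftrightarrow> joins_to m m' \<or> joins_to m' m"
proof
  assume nz: "Wcoef m m' \<noteq> 0"
  show "joins_to m m' \<or> joins_to m' m"
  proof (rule ccontr)
    assume no: "\<not> (joins_to m m' \<or> joins_to m' m)"
    have "Wcoef m m' = 0"
      unfolding Wcoef_eq_0_iff
    proof (intro conjI ballI impI notI)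
      fix i j assume ij: "i \<in> {1..wt m}" "j \<in> {1..wt m}"
      {
        assume *: "P (bar i) (i + j) \<in># m"
          "m' = m - {#P (bar i) (i + j)#} + {#P (bar i) i, P True j#}"
        have "m = m - {#P (bar i) (i + j)#} + {#P (bar i) (i + j)#}" using *(1) by simp
        hence "joins_to m' m" unfolding joins_to_def using ij *(2) atLeastAtMost_iff by blast
        thus False using no by blast
      next
        assume *: "P (bar i) i \<in># m" "P True j \<in># m - {#P (bar i) i#}"
          "m' = m - {#P (bar i) i#} - {#P True j#} + {#P (bar i) (i + j)#}"
        have "m = m - {#P (bar i) i#} - {#P True j#} + {#P (bar i) i, P True j#}"
          using insert_DiffM[OF *(1)] insert_DiffM[OF *(2)] by simp
        hence "joins_to m m'" unfolding joins_to_def using ij *(3) atLeastAtMost_iff by blast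
        thus False using no by blast
      }
    next
      fix i assume i: "i \<in> {1..wt m}"
      {
        assume *: "Q i \<in># m" "m' = m - {#Q i#} + {#P True (2 * i)#}"
        have "m = m - {#Q i#} + {#Q i#}" using *(1) by simp
        hence "joins_to m' m" unfolding joins_to_def using i *(2) atLeastAtMost_iff by blast
        thus False using no by blast
      next
        assume *: "P True (2 * i) \<in># m" "m' = m - {#P True (2 * i)#} + {#Q i#}"
        have "m = m - {#P True (2 * i)#} + {#P True (2 * i)#}" using *(1) by simp
        hence "joins_to m m'" unfolding joins_to_def using i *(2) atLeastAtMost_iff by blast
        thus False using no by blast
      }
    qed
    thus False using nz by simp
  qed
next
  assume "joins_to m m' \<or> joins_to m' m"
  thus "Wcoef m m' \<noteq> 0"
  proof
    assume "joins_to m m'"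
    thus ?thesis unfolding joins_to_def
    proof (elim disjE exE conjE)
      fix r i j assume *: "1 \<le> i" "1 \<le> j" "m = r + {#P (bar i) i, P True j#}"
        "m' = r + {#P (bar i) (i + j)#}"
      hence "i \<in> {1..wt m}" "j \<in> {1..wt m}"
        using vidx_le_wt[of "P (bar i) i" m] vidx_le_wt[of "P True j" m] by auto
      moreover have "P (bar i) i \<in># m" "P True j \<in># m - {#P (bar i) i#}"
        "m' = m - {#P (bar i) i#} - {#P True j#} + {#P (bar i) (i + j)#}" using * by auto
      ultimately show ?thesis unfolding Wcoef_eq_0_iff by blast
    next
      fix r i assume *: "1 \<le> i" "m = r + {#P True (2 * i)#}" "m' = r + {#Q i#}"
      hence "i \<in> {1..wt m}" using vidx_le_wt[of "P True (2 * i)" m] by auto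
      moreover have "P True (2 * i) \<in># m" "m' = m - {#P True (2 * i)#} + {#Q i#}" using * by auto
      ultimately show ?thesis unfolding Wcoef_eq_0_iff by blast
    qed
  next
    assume "joins_to m' m"
    thus ?thesis unfolding joins_to_def
    proof (elim disjE exE conjE)
      fix r i j assume *: "1 \<le> i" "1 \<le> j" "m' = r + {#P (bar i) i, P True j#}"
        "m = r + {#P (bar i) (i + j)#}"
      hence "i \<in> {1..wt m}" "j \<in> {1..wt m}"
        using vidx_le_wt[of "P (bar i) (i + j)" m] by auto
      moreover have "P (bar i) (i + j) \<in># m"
        "m' = m - {#P (bar i) (i + j)#} + {#P (bar i) i, P True j#}" using * by auto
      ultimately show ?thesis unfolding Wcoef_eq_0_iff by blast
    next
      fix r i assume *: "1 \<le> i" "m' = r + {#P True (2 * i)#}" "m = r + {#Q i#}"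
      hence "i \<in> {1..wt m}" using vidx_le_wt[of "Q i" m] by auto
      moreover have "Q i \<in># m" "m' = m - {#Q i#} + {#P True (2 * i)#}" using * by auto
      ultimately show ?thesis unfolding Wcoef_eq_0_iff by blast
    qed
  qed
qed

lemma Wcoef_nonzero_sym: "Wcoef m m' \<noteq> 0 \<Longrightarrow> Wcoef m' m \<noteq> 0"
  unfolding Wcoef_nonzero_iff by blast

lemma Wcoef_nonzero_Mons: "Wcoef m m' \<noteq> 0 \<Longrightarrow> m \<in> Mons np nm \<Longrightarrow> m' \<in> Mons np nm"
  unfolding Wcoef_nonzero_iff using joins_to_Mons by blast

section \<open>Transpositions as single moves\<close>

lemma finite_states: "finite (states np nm)"
proof -
  have "states np nm \<subseteq> Pow ({..<np} \<times> {..<nm})" by (auto simp: states_def is_state_def)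
  thus ?thesis by (rule finite_subset) simp
qed

lemma finite_transitions: "finite (transitions np nm)"
  by (simp add: transitions_def finite_states)

definition free_pairs :: "nat \<Rightarrow> nat \<Rightarrow> state \<Rightarrow> (nat \<times> nat) set" where
  "free_pairs np nm s = {p \<in> {..<np} \<times> {..<nm}. fst p \<notin> Domain s \<and> snd p \<notin> Range s}"

lemma transpositions_from:
  assumes "s \<in> states np nm"
  shows "{s' \<in> states np nm. is_transposition np nm (s, s')} =
           (\<lambda>p. s - {p}) ` s \<union> (\<lambda>p. insert p s) ` free_pairs np nm s"
proof (intro equalityI subsetI)
  fix s' assume "s' \<in> {s' \<in> states np nm. is_transposition np nm (s, s')}"
  then obtain a b where s': "s' \<in> states np nm" and ab: "a < np" "b < nm"
    and "(a, b) \<notin> s \<and> s' = insert (a, b) s \<or> (a, b) \<notin> s' \<and> s = insert (a, b) s'"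
    unfolding is_transposition_def by auto
  from this(4) show "s' \<in> (\<lambda>p. s - {p}) ` s \<union> (\<lambda>p. insert p s) ` free_pairs np nm s"
  proof
    assume *: "(a, b) \<notin> s \<and> s' = insert (a, b) s"
    \<comment> \<open>Because the enlarged set is still a state, neither element of the new pair can
      be matched in \<open>s\<close>.\<close>
    have "is_state np nm s'" using s' by (simp add: states_def)
    hence "a \<notin> Domain s" "b \<notin> Range s" using * unfolding is_state_def by blast+
    hence "(a, b) \<in> free_pairs np nm s" using ab by (simp add: free_pairs_def)
    thus ?thesis using * by blast
  next
    assume "(a, b) \<notin> s' \<and> s = insert (a, b) s'"
    hence "s' = s - {(a, b)}" "(a, b) \<in> s" by auto
    thus ?thesis by blast
  qed
next
  fix s' assume "s' \<in> (\<lambda>p. s - {p}) ` s \<union> (\<lambda>p. insert p s) ` free_pairs np nm s"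
  thus "s' \<in> {s' \<in> states np nm. is_transposition np nm (s, s')}"
  proof
    assume "s' \<in> (\<lambda>p. s - {p}) ` s"
    then obtain a b where *: "(a, b) \<in> s" "s' = s - {(a, b)}" by auto
    hence "a < np" "b < nm" using assms by (auto simp: states_def is_state_def)
    moreover have "(a, b) \<notin> s'" "s = insert (a, b) s'" using * by auto
    ultimately have "is_transposition np nm (s, s')"
      unfolding is_transposition_def fst_conv snd_conv by blast
    moreover have "s' \<in> states np nm"
      using assms *(2) unfolding states_def is_state_def by blast
    ultimately show ?thesis by simp
  next
    assume "s' \<in> (\<lambda>p. insert p s) ` free_pairs np nm s"
    then obtain a b where *: "(a, b) \<in> free_pairs np nm s" "s' = insert (a, b) s" by auto
    hence ab: "a < np" "b < nm" "a \<notin> Domain s" "b \<notin> Range s" by (simp_all add: free_pairs_def)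
    hence "(a, b) \<notin> s" by blast
    hence "is_transposition np nm (s, s')"
      unfolding is_transposition_def fst_conv snd_conv using ab *(2) by blast
    moreover have "is_state np nm s" using assms by (simp add: states_def)
    hence "is_state np nm s'"
      unfolding is_state_def *(2) using ab by (simp add: Domain_iff Range_iff)
    ultimately show ?thesis by (simp add: states_def)
  qed
qed

text \<open>Different moves lead to different states, so a sum over neighbours is a sum over
  moves.\<close>

lemma sum_transpositions:
  assumes "s \<in> states np nm"
  shows "sum f {s' \<in> states np nm. is_transposition np nm (s, s')} =
           (\<Sum>p\<in>s. f (s - {p})) + (\<Sum>p\<in>free_pairs np nm s. f (insert p s))"
proof -
  have fin: "finite s" "finite (free_pairs np nm s)"
    using assms finite_subset[of s "{..<np} \<times> {..<nm}"]
    by (auto simp: states_def is_state_def free_pairs_def)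
  have free: "p \<notin> s" if "p \<in> free_pairs np nm s" for p
    using that by (cases p) (auto simp: free_pairs_def)
  have "inj_on (\<lambda>p. s - {p}) s" by (rule inj_onI) blast
  moreover have "inj_on (\<lambda>p. insert p s) (free_pairs np nm s)"
    by (rule inj_onI) (metis free insertE insertI1)
  moreover have "(\<lambda>p. s - {p}) ` s \<inter> (\<lambda>p. insert p s) ` free_pairs np nm s = {}"
    using free by blast
  ultimately show ?thesis
    unfolding transpositions_from[OF assms] using fin by (simp add: sum.union_disjoint sum.reindex)
qed

lemma type_of_in_Types:
  assumes "s \<in> states np nm" "s' \<in> states np nm"
  shows "type_of np nm (s, s') \<in> Types np nm"
proof -
  interpret alternating_graph "vertices np nm" "arcs s s'"
    using assms by (rule alternating_arcs)
  show ?thesis unfolding Types_iff by (simp add: pmon_type_of mon_in_Mons)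
qed

text \<open>With \<open>s''\<close> fixed, the neighbours of \<open>s\<close> are the cuts and joins
  of \<open>arcs s s''\<close> at arcs leaving N+. The resulting number depends on
  \<open>(s, s'')\<close> only through its type.\<close>

lemma sum_C2_type_of:
  assumes s: "s \<in> states np nm" and s'': "s'' \<in> states np nm"
  shows "(\<Sum>s'\<in>states np nm. C2 np nm (s, s') * ind (type_of np nm (s', s'') = \<mu>)) =
           Wcoef (pmon (type_of np nm (s, s''))) (pmon \<mu>)"
proof -
  let ?V = "vertices np nm" and ?R = "arcs s s''"
  interpret alternating_graph ?V ?R using assms by (rule alternating_arcs)
  have type: "type_of np nm (s', s'') = \<mu> \<longleftrightarrow> mon ?V (arcs s' s'') = pmon \<mu>"
    if "s' \<in> states np nm" for s'
    using alternating_graph.pmon_type_of[OF alternating_arcs[OF that s''] refl refl] inj_pmon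
    by (metis injD)
  have "(\<Sum>s'\<in>states np nm. C2 np nm (s, s') * ind (type_of np nm (s', s'') = \<mu>)) =
      (\<Sum>s'\<in>{s' \<in> states np nm. is_transposition np nm (s, s')}. ind (mon ?V (arcs s' s'') = pmon \<mu>))"
    using s type by (intro sum.mono_neutral_cong_right finite_states)
      (auto simp: C2_def transitions_def)
  also have "\<dots> = (\<Sum>p\<in>s. ind (mon ?V (?R - {arc p}) = pmon \<mu>)) +
      (\<Sum>p\<in>free_pairs np nm s. ind (mon ?V (insert (arc p) ?R) = pmon \<mu>))"
    unfolding sum_transpositions[OF s] arcs_insert arcs_remove ..
  also have "(\<Sum>p\<in>s. ind (mon ?V (?R - {arc p}) = pmon \<mu>)) =
      (\<Sum>e\<in>arc ` s. ind (mon ?V (?R - {e}) = pmon \<mu>))"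
    using inj_on_subset[OF inj_arc subset_UNIV] by (simp add: sum.reindex)
  also have "arc ` s = {e \<in> ?R. isl (fst e)}"
    by (auto simp: arcs_def arc_def)
  also have "(\<Sum>p\<in>free_pairs np nm s. ind (mon ?V (insert (arc p) ?R) = pmon \<mu>)) =
      (\<Sum>e\<in>arc ` free_pairs np nm s. ind (mon ?V (insert e ?R) = pmon \<mu>))"
    using inj_on_subset[OF inj_arc subset_UNIV] by (simp add: sum.reindex)
  also have "arc ` free_pairs np nm s = ends \<times> starts"
  proof (intro equalityI subsetI)
    fix e assume "e \<in> arc ` free_pairs np nm s"
    thus "e \<in> ends \<times> starts"
      by (auto simp: free_pairs_def ends_def starts_def arc_def elim!: arcsE)
  next
    fix e assume e: "e \<in> ends \<times> starts"
    then obtain a b where ab: "e = arc (a, b)"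
      by (cases e; cases "fst e"; cases "snd e") (auto simp: ends_def starts_def arc_def)
    hence "a < np" "b < nm" "Inl a \<notin> Domain ?R" "Inr b \<notin> Range ?R"
      using e by (auto simp: ends_def starts_def arc_def)
    hence "(a, b) \<in> free_pairs np nm s"
      by (auto simp: free_pairs_def) (meson Domain.DomainI Range.intros mem_arcs(1))+
    thus "e \<in> arc ` free_pairs np nm s" using ab by blast
  qed
  finally show ?thesis by (simp add: sum_moves pmon_type_of)
qed

section \<open>Double counting and the structure constants\<close>

lemma C2_sym: "C2 np nm (s, s') = C2 np nm (s', s)"
  by (auto simp: C2_def is_transposition_def transitions_def)

text \<open>Both sides count triples \<open>(s, s', s'')\<close> with \<open>s\<close> and
  \<open>s'\<close> related by a transposition, \<open>(s, s'')\<close> of type \<open>\<nu>\<close>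
  and \<open>(s', s'')\<close> of type \<open>\<mu>\<close>; exchanging \<open>s\<close> and
  \<open>s'\<close> gives the symmetry.\<close>

lemma cardC_Wcoef:
  "of_nat (cardC np nm \<nu>) * Wcoef (pmon \<nu>) (pmon \<mu>) =
   of_nat (cardC np nm \<mu>) * Wcoef (pmon \<mu>) (pmon \<nu>)"
proof -
  let ?S = "states np nm" and ?t = "type_of np nm"
  have count: "of_nat (cardC np nm \<nu>) * Wcoef (pmon \<nu>) (pmon \<mu>) =
    (\<Sum>s\<in>?S. \<Sum>s''\<in>?S. \<Sum>s'\<in>?S. ind (?t (s, s'') = \<nu>) * C2 np nm (s, s') * ind (?t (s', s'') = \<mu>))"
    for \<mu> \<nu>
  proof -
    have "of_nat (cardC np nm \<nu>) = (\<Sum>t\<in>transitions np nm. ind (?t t = \<nu>))"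
      using finite_transitions by (simp add: cardC_def ind_def sum.If_cases Int_def)
    hence "of_nat (cardC np nm \<nu>) * Wcoef (pmon \<nu>) (pmon \<mu>) =
      (\<Sum>s\<in>?S. \<Sum>s''\<in>?S. ind (?t (s, s'') = \<nu>) * Wcoef (pmon \<nu>) (pmon \<mu>))"
      by (simp add: transitions_def sum_distrib_right sum.cartesian_product)
    also have "\<dots> = (\<Sum>s\<in>?S. \<Sum>s''\<in>?S. ind (?t (s, s'') = \<nu>) *
        (\<Sum>s'\<in>?S. C2 np nm (s, s') * ind (?t (s', s'') = \<mu>)))"
    proof (intro sum.cong refl)
      fix s s'' assume s: "s \<in> ?S" "s'' \<in> ?S"
      show "ind (?t (s, s'') = \<nu>) * Wcoef (pmon \<nu>) (pmon \<mu>) = ind (?t (s, s'') = \<nu>) *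
        (\<Sum>s'\<in>?S. C2 np nm (s, s') * ind (?t (s', s'') = \<mu>))"
        unfolding sum_C2_type_of[OF s] by (simp add: ind_def)
    qed
    finally show ?thesis by (simp add: sum_distrib_left mult.assoc)
  qed
  have "of_nat (cardC np nm \<nu>) * Wcoef (pmon \<nu>) (pmon \<mu>) =
    (\<Sum>s''\<in>?S. \<Sum>s\<in>?S. \<Sum>s'\<in>?S. ind (?t (s, s'') = \<nu>) * C2 np nm (s, s') * ind (?t (s', s'') = \<mu>))"
    unfolding count by (rule sum.swap)
  also have "\<dots> = (\<Sum>s''\<in>?S. \<Sum>s'\<in>?S. \<Sum>s\<in>?S.
      ind (?t (s, s'') = \<nu>) * C2 np nm (s, s') * ind (?t (s', s'') = \<mu>))"
    by (intro sum.cong refl sum.swap)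
  also have "\<dots> = (\<Sum>s'\<in>?S. \<Sum>s''\<in>?S. \<Sum>s\<in>?S.
      ind (?t (s', s'') = \<mu>) * C2 np nm (s', s) * ind (?t (s, s'') = \<nu>))"
    by (subst sum.swap) (simp add: C2_sym[of np nm] mult_ac)
  also have "\<dots> = of_nat (cardC np nm \<mu>) * Wcoef (pmon \<mu>) (pmon \<nu>)"
    unfolding count ..
  finally show ?thesis .
qed

theorem theorem4p1:
  fixes np nm :: nat and \<mu> :: ttype
  assumes "\<mu> \<in> Types np nm"
  shows "tmul np nm (C2 np nm) (\<lambda>t. Cmu np nm \<mu> t / of_nat (cardC np nm \<mu>))
           = (\<lambda>t. \<Sum>\<nu>\<in>Types np nm.
                   Wcoef (pmon \<mu>) (pmon \<nu>) * (Cmu np nm \<nu> t / of_nat (cardC np nm \<nu>)))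
         \<and> (\<forall>m'. Wcoef (pmon \<mu>) m' \<noteq> 0 \<longrightarrow> m' \<in> pmon ` Types np nm)"
proof (intro conjI ext allI impI)
  \<comment> \<open>W+ preserves bidegree, so the sum over \<open>Types np nm\<close> omits no
    monomial of its value.\<close>
  fix m' assume "Wcoef (pmon \<mu>) m' \<noteq> 0"
  thus "m' \<in> pmon ` Types np nm"
    using Wcoef_nonzero_Mons assms unfolding pmon_image_Types Types_iff by blast
next
  fix t :: transition
  obtain s s'' where t: "t = (s, s'')" by (cases t)
  let ?n = "\<lambda>\<mu>. of_nat (cardC np nm \<mu>) :: rat"
  show "tmul np nm (C2 np nm) (\<lambda>t. Cmu np nm \<mu> t / ?n \<mu>) t =
    (\<Sum>\<nu>\<in>Types np nm. Wcoef (pmon \<mu>) (pmon \<nu>) * (Cmu np nm \<nu> t / ?n \<nu>))"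
  proof (cases "t \<in> transitions np nm")
    case False
    hence "C2 np nm (s, s') * (Cmu np nm \<mu> (s', s'') / ?n \<mu>) = 0" for s'
      by (auto simp: t C2_def Cmu_def transitions_def)
    hence "tmul np nm (C2 np nm) (\<lambda>t. Cmu np nm \<mu> t / ?n \<mu>) t = 0"
      unfolding tmul_def t prod.case by (intro sum.neutral ballI)
    moreover have "Cmu np nm \<nu> t = 0" for \<nu> using False by (simp add: Cmu_def)
    ultimately show ?thesis by simp
  next
    case True
    hence s: "s \<in> states np nm" "s'' \<in> states np nm" by (auto simp: t transitions_def)
    let ?\<nu> = "type_of np nm t"
    have "tmul np nm (C2 np nm) (\<lambda>t. Cmu np nm \<mu> t / ?n \<mu>) t =
        (\<Sum>s'\<in>states np nm. C2 np nm (s, s') * ind (type_of np nm (s', s'') = \<mu>) / ?n \<mu>)"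
      unfolding tmul_def t prod.case using s
      by (intro sum.cong refl) (simp add: Cmu_def transitions_def ind_def)
    also have "\<dots> = Wcoef (pmon ?\<nu>) (pmon \<mu>) / ?n \<mu>"
      by (simp add: sum_C2_type_of[OF s] t flip: sum_divide_distrib)
    \<comment> \<open>The count runs from the type of \<open>t\<close> to \<open>\<mu>\<close>; the
      weighted symmetry reverses it and changes the denominator.\<close>
    also have "\<dots> = Wcoef (pmon \<mu>) (pmon ?\<nu>) / ?n ?\<nu>"
    proof -
      \<comment> \<open>The class contains \<open>t\<close> itself.\<close>
      have "?n ?\<nu> \<noteq> 0"
        using True finite_transitions by (auto simp: t cardC_def card_eq_0_iff)
      moreover note cardC_Wcoef[of np nm ?\<nu> \<mu>]
      \<comment> \<open>Here the left side is 0 by the convention for division. The weighted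
        symmetry makes the reversed coefficient vanish, and symmetry of the support passes this on,
        so the right side is 0 too.\<close>
      moreover have "Wcoef (pmon \<mu>) (pmon ?\<nu>) = 0" if "?n \<mu> = 0"
        using calculation that Wcoef_nonzero_sym by (metis mult_eq_0_iff)
      ultimately show ?thesis by (cases "?n \<mu> = 0") (simp_all add: field_simps)
    qed
    \<comment> \<open>Exactly one class contains \<open>t\<close>, so a single summand
      survives.\<close>
    also have "\<dots> = (\<Sum>\<nu>\<in>Types np nm. if \<nu> = ?\<nu> then Wcoef (pmon \<mu>) (pmon \<nu>) / ?n \<nu> else 0)"
      using type_of_in_Types[OF s] finite_Types by (simp add: t)
    also have "\<dots> = (\<Sum>\<nu>\<in>Types np nm. Wcoef (pmon \<mu>) (pmon \<nu>) * (Cmu np nm \<nu> t / ?n \<nu>))"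
      using True by (intro sum.cong refl) (auto simp: Cmu_def)
    finally show ?thesis .
  qed
qed

end
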